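(* The class of tame locally convex spaces is closed under taking (1) linear subspaces, (2) images under bound covering continuous linear maps, (3) arbitrary products, (4) locally convex direct sums, (5) inverse limits. Moreover, if $F$ is a large dense subspace of a locally convex space $E$ and $F$ is tame, then $E$ is tame; in particular, the completion of a tame normed space is tame.
   Context: ${\rm eqc}(E^* )$: equicontinuous weak-star compact subsets of $E^*$. A sequence of real functions $(f_n)$ on a set is independent if there are $a<b$ with $\bigcap_{n\in P} f_n^{-1}(-\infty,a)\cap\bigcap_{n\in M} f_n^{-1}(b,\infty)\neq\emptyset$ for all finite disjoint $P,M\subseteq\mathbb N$; a bounded family is tame if it has no independent sequence. $E$ is tame if for every bounded $B\subseteq E$ and every $K\in{\rm eqc}(E^* )$ the family $\{\varphi\mapsto\varphi(b)\}_{b\in B}$ on $K$ is tame. A continuous linear map $f\colon E_1\to E_2$ is bound covering if for every bounded $B_2\subseteq E_2$ there is a bounded $B_1\subseteq E_1$ with $f(B_1)=B_2$ (such $f$ is then surjective and tameness passes from $E_1$ to $E_2$). A dense subspace $F\subseteq E$ is large if every bounded subset of $E$ is contained in the closure of a bounded subset of $F$. *)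

theory Defs
  imports "HOL-Analysis.Analysis" "HOL-Library.Function_Algebras"
begin

text \<open>A locally convex space is modelled as a linear subspace S of an ambient real
vector space together with a family P of seminorms on S generating its topology.\<close>

definition seminorm_on :: "'a::real_vector set \<Rightarrow> ('a \<Rightarrow> real) \<Rightarrow> bool" where
  "seminorm_on S p \<longleftrightarrow> (\<forall>x\<in>S. 0 \<le> p x) \<and> (\<forall>x\<in>S. \<forall>y\<in>S. p (x + y) \<le> p x + p y)
     \<and> (\<forall>c. \<forall>x\<in>S. p (c *\<^sub>R x) = \<bar>c\<bar> * p x)"

definition lcs :: "'a::real_vector set \<Rightarrow> ('a \<Rightarrow> real) set \<Rightarrow> bool" where
  "lcs S P \<longleftrightarrow> subspace S \<and> (\<forall>p\<in>P. seminorm_on S p)"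

text \<open>q is continuous at 0 w.r.t. the topology generated by P (dominated by a finite sum).\<close>
definition dominated :: "'a::real_vector set \<Rightarrow> ('a \<Rightarrow> real) set \<Rightarrow> ('a \<Rightarrow> real) \<Rightarrow> bool" where
  "dominated S P q \<longleftrightarrow> (\<exists>F C. finite F \<and> F \<subseteq> P \<and> (\<forall>x\<in>S. q x \<le> C * (\<Sum>p\<in>F. p x)))"

definition lcs_bounded :: "'a::real_vector set \<Rightarrow> ('a \<Rightarrow> real) set \<Rightarrow> 'a set \<Rightarrow> bool" where
  "lcs_bounded S P B \<longleftrightarrow> B \<subseteq> S \<and> (\<forall>p\<in>P. \<exists>M. \<forall>x\<in>B. p x \<le> M)"

definition lcs_dual :: "'a::real_vector set \<Rightarrow> ('a \<Rightarrow> real) set \<Rightarrow> ('a \<Rightarrow> real) set" where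
  "lcs_dual S P = {\<phi>. (\<forall>x\<in>S. \<forall>y\<in>S. \<phi> (x + y) = \<phi> x + \<phi> y) \<and> (\<forall>c. \<forall>x\<in>S. \<phi> (c *\<^sub>R x) = c * \<phi> x)
      \<and> dominated S P (\<lambda>x. \<bar>\<phi> x\<bar>) \<and> (\<forall>x. x \<notin> S \<longrightarrow> \<phi> x = 0)}"

definition equicontinuous :: "'a::real_vector set \<Rightarrow> ('a \<Rightarrow> real) set \<Rightarrow> ('a \<Rightarrow> real) set \<Rightarrow> bool" where
  "equicontinuous S P K \<longleftrightarrow> K \<subseteq> lcs_dual S P \<and>
     (\<exists>F C. finite F \<and> F \<subseteq> P \<and> (\<forall>\<phi>\<in>K. \<forall>x\<in>S. \<bar>\<phi> x\<bar> \<le> C * (\<Sum>p\<in>F. p x)))"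

text \<open>eqc(E*): equicontinuous weak-star compact subsets. Weak-star compactness is compactness
in the topology of pointwise convergence (product topology on functions).\<close>
definition eqc :: "'a::real_vector set \<Rightarrow> ('a \<Rightarrow> real) set \<Rightarrow> ('a \<Rightarrow> real) set set" where
  "eqc S P = {K. equicontinuous S P K \<and> compact K}"

definition independent_seq :: "'k set \<Rightarrow> (nat \<Rightarrow> 'k \<Rightarrow> real) \<Rightarrow> bool" where
  "independent_seq K f \<longleftrightarrow> (\<exists>a b. a < b \<and> (\<forall>Pn Mn. finite Pn \<and> finite Mn \<and> Pn \<inter> Mn = {} \<longrightarrow>
      (\<exists>x\<in>K. (\<forall>n\<in>Pn. f n x < a) \<and> (\<forall>n\<in>Mn. b < f n x))))"

definition tame_family :: "'k set \<Rightarrow> ('k \<Rightarrow> real) set \<Rightarrow> bool" where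
  "tame_family K F \<longleftrightarrow> \<not> (\<exists>f. range f \<subseteq> F \<and> independent_seq K f)"

definition tame_lcs :: "'a::real_vector set \<Rightarrow> ('a \<Rightarrow> real) set \<Rightarrow> bool" where
  "tame_lcs S P \<longleftrightarrow> (\<forall>B K. lcs_bounded S P B \<longrightarrow> K \<in> eqc S P \<longrightarrow>
      tame_family K ((\<lambda>b \<phi>. \<phi> b) ` B))"

definition cont_linear :: "'a::real_vector set \<Rightarrow> ('a \<Rightarrow> real) set \<Rightarrow> 'b::real_vector set \<Rightarrow> ('b \<Rightarrow> real) set
     \<Rightarrow> ('a \<Rightarrow> 'b) \<Rightarrow> bool" where
  "cont_linear S1 P1 S2 P2 f \<longleftrightarrow> f ` S1 \<subseteq> S2 \<and>
     (\<forall>x\<in>S1. \<forall>y\<in>S1. f (x + y) = f x + f y) \<and> (\<forall>c. \<forall>x\<in>S1. f (c *\<^sub>R x) = c *\<^sub>R f x) \<and>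
     (\<forall>q\<in>P2. dominated S1 P1 (\<lambda>x. q (f x)))"

definition bound_covering :: "'a::real_vector set \<Rightarrow> ('a \<Rightarrow> real) set \<Rightarrow> 'b::real_vector set \<Rightarrow> ('b \<Rightarrow> real) set
     \<Rightarrow> ('a \<Rightarrow> 'b) \<Rightarrow> bool" where
  "bound_covering S1 P1 S2 P2 f \<longleftrightarrow> cont_linear S1 P1 S2 P2 f \<and>
     (\<forall>B2. lcs_bounded S2 P2 B2 \<longrightarrow> (\<exists>B1. lcs_bounded S1 P1 B1 \<and> f ` B1 = B2))"

instantiation "fun" :: (type, real_vector) real_vector
begin
definition scaleR_fun :: "real \<Rightarrow> ('a \<Rightarrow> 'b) \<Rightarrow> 'a \<Rightarrow> 'b" where
  "scaleR_fun c f = (\<lambda>x. c *\<^sub>R f x)"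
instance by standard (auto simp: scaleR_fun_def fun_eq_iff scaleR_add_right scaleR_add_left)
end

definition prod_carrier :: "'i set \<Rightarrow> ('i \<Rightarrow> 'a::real_vector set) \<Rightarrow> ('i \<Rightarrow> 'a) set" where
  "prod_carrier I S = {x. (\<forall>i\<in>I. x i \<in> S i) \<and> (\<forall>i. i \<notin> I \<longrightarrow> x i = 0)}"

definition prod_seminorms :: "'i set \<Rightarrow> ('i \<Rightarrow> ('a::real_vector \<Rightarrow> real) set) \<Rightarrow> (('i \<Rightarrow> 'a) \<Rightarrow> real) set" where
  "prod_seminorms I P = {(\<lambda>x. p (x i)) | i p. i \<in> I \<and> p \<in> P i}"

text \<open>Locally convex direct sum: finitely supported elements, with the finest locally convex
topology making all canonical injections continuous, i.e. generated by all seminorms whose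
composition with every injection is continuous.\<close>
definition dsum_carrier :: "'i set \<Rightarrow> ('i \<Rightarrow> 'a::real_vector set) \<Rightarrow> ('i \<Rightarrow> 'a) set" where
  "dsum_carrier I S = {x \<in> prod_carrier I S. finite {i. x i \<noteq> 0}}"

definition dsum_inj :: "'i \<Rightarrow> 'a::real_vector \<Rightarrow> ('i \<Rightarrow> 'a)" where
  "dsum_inj i v = (\<lambda>j. if j = i then v else 0)"

definition dsum_seminorms :: "'i set \<Rightarrow> ('i \<Rightarrow> 'a::real_vector set) \<Rightarrow> ('i \<Rightarrow> ('a \<Rightarrow> real) set)
     \<Rightarrow> (('i \<Rightarrow> 'a) \<Rightarrow> real) set" where
  "dsum_seminorms I S P = {q. seminorm_on (dsum_carrier I S) q \<and>
      (\<forall>i\<in>I. dominated (S i) (P i) (\<lambda>v. q (dsum_inj i v)))}"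

definition inverse_system :: "'i set \<Rightarrow> ('i \<Rightarrow> 'i \<Rightarrow> bool) \<Rightarrow> ('i \<Rightarrow> 'a::real_vector set)
     \<Rightarrow> ('i \<Rightarrow> ('a \<Rightarrow> real) set) \<Rightarrow> ('i \<Rightarrow> 'i \<Rightarrow> 'a \<Rightarrow> 'a) \<Rightarrow> bool" where
  "inverse_system I le S P f \<longleftrightarrow>
     (\<forall>i\<in>I. le i i) \<and> (\<forall>i\<in>I. \<forall>j\<in>I. \<forall>k\<in>I. le i j \<longrightarrow> le j k \<longrightarrow> le i k) \<and>
     (\<forall>i\<in>I. \<forall>j\<in>I. le i j \<longrightarrow> le j i \<longrightarrow> i = j) \<and>
     (\<forall>i\<in>I. \<forall>j\<in>I. \<exists>k\<in>I. le i k \<and> le j k) \<and>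
     (\<forall>i\<in>I. lcs (S i) (P i)) \<and>
     (\<forall>i\<in>I. \<forall>j\<in>I. le i j \<longrightarrow> cont_linear (S j) (P j) (S i) (P i) (f i j)) \<and>
     (\<forall>i\<in>I. \<forall>x\<in>S i. f i i x = x) \<and>
     (\<forall>i\<in>I. \<forall>j\<in>I. \<forall>k\<in>I. le i j \<longrightarrow> le j k \<longrightarrow> (\<forall>x\<in>S k. f i j (f j k x) = f i k x))"

definition invlim_carrier :: "'i set \<Rightarrow> ('i \<Rightarrow> 'i \<Rightarrow> bool) \<Rightarrow> ('i \<Rightarrow> 'a::real_vector set)
     \<Rightarrow> ('i \<Rightarrow> 'i \<Rightarrow> 'a \<Rightarrow> 'a) \<Rightarrow> ('i \<Rightarrow> 'a) set" where
  "invlim_carrier I le S f = {x \<in> prod_carrier I S. \<forall>i\<in>I. \<forall>j\<in>I. le i j \<longrightarrow> f i j (x j) = x i}"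

definition lcs_closure :: "'a::real_vector set \<Rightarrow> ('a \<Rightarrow> real) set \<Rightarrow> 'a set \<Rightarrow> 'a set" where
  "lcs_closure S P A = {x \<in> S. \<forall>G e. finite G \<and> G \<subseteq> P \<and> 0 < e \<longrightarrow>
      (\<exists>y\<in>A. (\<Sum>p\<in>G. p (x - y)) < e)}"

definition large_dense :: "'a::real_vector set \<Rightarrow> ('a \<Rightarrow> real) set \<Rightarrow> 'a set \<Rightarrow> bool" where
  "large_dense S P F \<longleftrightarrow> subspace F \<and> F \<subseteq> S \<and> S \<subseteq> lcs_closure S P F \<and>
     (\<forall>B. lcs_bounded S P B \<longrightarrow> (\<exists>B'. B' \<subseteq> F \<and> lcs_bounded S P B' \<and> B \<subseteq> lcs_closure S P B'))"

end

theory Submission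
  imports Defs
begin

text \<open>The heart of the matter is that tameness survives finite sums: if \<open>f\<^sub>n + g\<^sub>n\<close> is independent and the
\<open>f\<^sub>n\<close> are uniformly bounded, then \<open>f\<close> or \<open>g\<close> has an independent subsequence. Cutting the range of \<open>f\<^sub>n\<close>
into finitely many cells reduces this to a partition property: if the pairs \<open>(A\<^sub>n, B\<^sub>n)\<close> are independent
and \<open>A\<^sub>n \<subseteq> A1\<^sub>n \<union> A2\<^sub>n\<close>, then along a subsequence \<open>(A1\<^sub>n, B\<^sub>n)\<close> or \<open>(A2\<^sub>n, B\<^sub>n)\<close> is independent. An
equicontinuous set of functionals on a product depends on finitely many coordinates only, and a bounded
subset of a direct sum is essentially supported on finitely many, so both cases are finite sums of
functionals pulled back to tame factors. Subspaces are treated by extending an equicontinuous set of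
functionals with Hahn-Banach into a polar, which is compact; inverse limits are subspaces of products;
for a large dense subspace the independent sequence is perturbed into it.\<close>

subsection \<open>Independent pairs of sets\<close>

text \<open>Neither summand of an independent sum need be independent along the original sequence,
  and the two summands can balance differently at different points, so the thresholds of the sum say
  nothing about thresholds for one summand. Hence independence is detached from functions and stated
  for pairs of sets: pieces of the low and high sets are selected first, and new thresholds are
  chosen afterwards. Since independence concerns all finite patterns at once, the subsequence is
  built index by index, keeping every cell cut out so far alive on a common infinite reservoir of
  indices.

  Functionals are total functions vanishing off the carrier, so that weak-star convergence is
  pointwise convergence on the whole type and equality of functionals is equality of functions. This
  is why extensions, pullbacks and even the sublinear functionals entering Zorn's lemma are set to 0
  there.\<close>

definition indep_pairs :: "nat set \<Rightarrow> 'x set \<Rightarrow> (nat \<Rightarrow> 'x set) \<Rightarrow> (nat \<Rightarrow> 'x set) \<Rightarrow> bool" where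
  "indep_pairs N X A B \<longleftrightarrow> (\<forall>P Q. finite P \<and> finite Q \<and> P \<inter> Q = {} \<and> P \<subseteq> N \<and> Q \<subseteq> N \<longrightarrow>
     X \<inter> (\<Inter>n\<in>P. A n) \<inter> (\<Inter>n\<in>Q. B n) \<noteq> {})"

lemma indep_pairsD:
  assumes "indep_pairs N X A B" "finite P" "finite Q" "P \<inter> Q = {}" "P \<subseteq> N" "Q \<subseteq> N"
  obtains x where "x \<in> X" "\<And>n. n \<in> P \<Longrightarrow> x \<in> A n" "\<And>n. n \<in> Q \<Longrightarrow> x \<in> B n"
proof -
  have "X \<inter> (\<Inter>n\<in>P. A n) \<inter> (\<Inter>n\<in>Q. B n) \<noteq> {}"
    using assms unfolding indep_pairs_def by blast
  then show ?thesis using that by blast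
qed

lemma indep_pairs_mono:
  assumes "indep_pairs N X A B" "N' \<subseteq> N" "X \<subseteq> X'"
    and "\<And>n. n \<in> N' \<Longrightarrow> A n \<subseteq> A' n" "\<And>n. n \<in> N' \<Longrightarrow> B n \<subseteq> B' n"
  shows "indep_pairs N' X' A' B'"
  unfolding indep_pairs_def
proof (intro allI impI; elim conjE)
  fix P Q assume PQ: "finite P" "finite Q" "P \<inter> Q = {}" "P \<subseteq> N'" "Q \<subseteq> N'"
  obtain x where "x \<in> X" "\<And>n. n \<in> P \<Longrightarrow> x \<in> A n" "\<And>n. n \<in> Q \<Longrightarrow> x \<in> B n"
    using indep_pairsD[OF assms(1), of P Q] PQ assms(2) by blast
  then have "x \<in> X' \<inter> (\<Inter>n\<in>P. A' n) \<inter> (\<Inter>n\<in>Q. B' n)"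
    using assms(3-5) PQ(4,5) by blast
  then show "X' \<inter> (\<Inter>n\<in>P. A' n) \<inter> (\<Inter>n\<in>Q. B' n) \<noteq> {}" by blast
qed

lemma indep_pairs_sym: "indep_pairs N X A B \<Longrightarrow> indep_pairs N X B A"
  unfolding indep_pairs_def by (metis Int_assoc Int_commute)

lemma indep_pairs_Int:
  assumes "indep_pairs N X A B" "n \<in> N"
  shows "indep_pairs (N - {n}) (X \<inter> A n) A B"
  unfolding indep_pairs_def
proof (intro allI impI; elim conjE)
  fix P Q assume PQ: "finite P" "finite Q" "P \<inter> Q = {}" "P \<subseteq> N - {n}" "Q \<subseteq> N - {n}"
  obtain x where "x \<in> X" "\<And>m. m \<in> insert n P \<Longrightarrow> x \<in> A m" "\<And>m. m \<in> Q \<Longrightarrow> x \<in> B m"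
    using indep_pairsD[OF assms(1), of "insert n P" Q] PQ assms(2) by blast
  then show "X \<inter> A n \<inter> (\<Inter>n\<in>P. A n) \<inter> (\<Inter>n\<in>Q. B n) \<noteq> {}" by blast
qed

text \<open>A pattern that fails in \<open>U\<close> can be joined to any pattern avoiding its
  indices. The joint pattern is realised in the union, and the point cannot lie in \<open>U\<close>.
  So only the finitely many indices of one failing pattern have to be given up.\<close>

lemma indep_pairs_Un:
  assumes ind: "indep_pairs N (U \<union> V) A B" and U: "\<not> indep_pairs N U A B"
  obtains D where "finite D" "indep_pairs (N - D) V A B"
proof -
  obtain P Q where PQ: "finite P" "finite Q" "P \<inter> Q = {}" "P \<subseteq> N" "Q \<subseteq> N"
    and e: "U \<inter> (\<Inter>n\<in>P. A n) \<inter> (\<Inter>n\<in>Q. B n) = {}"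
    using U unfolding indep_pairs_def by auto
  have "indep_pairs (N - (P \<union> Q)) V A B"
    unfolding indep_pairs_def
  proof (intro allI impI; elim conjE)
    fix P' Q' assume PQ': "finite P'" "finite Q'" "P' \<inter> Q' = {}"
      "P' \<subseteq> N - (P \<union> Q)" "Q' \<subseteq> N - (P \<union> Q)"
    obtain x where "x \<in> U \<union> V" "\<And>m. m \<in> P \<union> P' \<Longrightarrow> x \<in> A m" "\<And>m. m \<in> Q \<union> Q' \<Longrightarrow> x \<in> B m"
      using indep_pairsD[OF ind, of "P \<union> P'" "Q \<union> Q'"] PQ PQ' by blast
    then show "V \<inter> (\<Inter>n\<in>P'. A n) \<inter> (\<Inter>n\<in>Q'. B n) \<noteq> {}" using e by blast
  qed
  then show ?thesis using that[of "P \<union> Q"] PQ by blast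
qed

text \<open>\<open>\<Phi> N Y\<close> is to be read as: the cell \<open>Y\<close> is still alive on
  the reservoir \<open>N\<close>. If finitely many live cells can always be cut by one index into
  pieces that are live over a common reservoir, iteration keeps every cell of every stage live,
  hence nonempty. The map \<open>g\<close> is not asked to be increasing, as the conclusion speaks
  only of the reindexed sets.\<close>

lemma indep_pairs_greedy:
  fixes \<Phi> :: "nat set \<Rightarrow> 'x set \<Rightarrow> bool"
  assumes step: "\<And>\<X> N. finite \<X> \<Longrightarrow> \<X> \<noteq> {} \<Longrightarrow> infinite N \<Longrightarrow> (\<And>Y. Y \<in> \<X> \<Longrightarrow> \<Phi> N Y) \<Longrightarrow>
      \<exists>n N'. infinite N' \<and> (\<forall>Y\<in>\<X>. \<Phi> N' (Y \<inter> A n) \<and> \<Phi> N' (Y \<inter> B n))"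
    and start: "infinite N0" "\<Phi> N0 Y0"
    and nonempty: "\<And>N Y. \<Phi> N Y \<Longrightarrow> Y \<noteq> {}"
  obtains g where "indep_pairs UNIV UNIV (A \<circ> g) (B \<circ> g)"
proof -
  define ok where "ok = (\<lambda>(t::nat) (\<X>, N). finite \<X> \<and> \<X> \<noteq> {} \<and> infinite N \<and> (\<forall>Y\<in>\<X>. \<Phi> N Y))"
  \<comment> \<open>Only the cutting of the cells is recorded; the infinite reservoir that keeps
    them live is left to \<open>ok\<close>. The dummy \<open>t\<close> matches the form of
    \<open>dependent_nat_choice\<close>.\<close>
  define nxt where "nxt = (\<lambda>(t::nat) (\<X>, N::nat set) (\<X>', N'::nat set).
      \<exists>n. \<X>' = (\<lambda>Y. Y \<inter> A n) ` \<X> \<union> (\<lambda>Y. Y \<inter> B n) ` \<X>)"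
  have "\<exists>s. \<forall>t. ok t (s t) \<and> nxt t (s t) (s (Suc t))"
  proof (rule dependent_nat_choice)
    show "\<exists>x. ok 0 x"
      using start by (intro exI[of _ "({Y0}, N0)"]) (auto simp: ok_def)
  next
    fix x t assume x: "ok t x"
    obtain \<X> N where xe: "x = (\<X>, N)" by (cases x)
    have X: "finite \<X>" "\<X> \<noteq> {}" "infinite N" "\<And>Y. Y \<in> \<X> \<Longrightarrow> \<Phi> N Y" using x xe by (auto simp: ok_def)
    obtain n N' where "infinite N'" "\<forall>Y\<in>\<X>. \<Phi> N' (Y \<inter> A n) \<and> \<Phi> N' (Y \<inter> B n)"
      using step[OF X] by blast
    then show "\<exists>y. ok (Suc t) y \<and> nxt t x y"
      using X xe
      by (intro exI[of _ "((\<lambda>Y. Y \<inter> A n) ` \<X> \<union> (\<lambda>Y. Y \<inter> B n) ` \<X>, N')"])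
        (auto simp: ok_def nxt_def)
  qed
  then obtain s where s: "\<And>t. ok t (s t)" "\<And>t. nxt t (s t) (s (Suc t))" by blast
  define \<Y> where "\<Y> = (\<lambda>t. fst (s t))"
  have "\<exists>n. \<Y> (Suc t) = (\<lambda>Y. Y \<inter> A n) ` \<Y> t \<union> (\<lambda>Y. Y \<inter> B n) ` \<Y> t" for t
    using s(2)[of t] by (auto simp: nxt_def \<Y>_def split: prod.splits)
  then obtain g where g: "\<And>t. \<Y> (Suc t) = (\<lambda>Y. Y \<inter> A (g t)) ` \<Y> t \<union> (\<lambda>Y. Y \<inter> B (g t)) ` \<Y> t"
    by metis
  have ne: "\<Y> t \<noteq> {}" "Y \<in> \<Y> t \<Longrightarrow> Y \<noteq> {}" for t Y
    using s(1)[of t] nonempty by (auto simp: ok_def \<Y>_def split: prod.splits)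
  have pat: "\<exists>Y\<in>\<Y> t. (\<forall>n\<in>P. n < t \<longrightarrow> Y \<subseteq> A (g n)) \<and> (\<forall>n\<in>Q. n < t \<longrightarrow> Y \<subseteq> B (g n))"
    if "P \<inter> Q = {}" for t P Q
  proof (induction t)
    case 0
    then show ?case using ne(1)[of 0] by auto
  next
    case (Suc t)
    then obtain Y where Y: "Y \<in> \<Y> t" "\<forall>n\<in>P. n < t \<longrightarrow> Y \<subseteq> A (g n)"
      "\<forall>n\<in>Q. n < t \<longrightarrow> Y \<subseteq> B (g n)" by blast
    show ?case
    proof (cases "t \<in> P")
      case True
      then have "t \<notin> Q" using that by blast
      moreover have "Y \<inter> A (g t) \<in> \<Y> (Suc t)" using g Y(1) by blast
      ultimately show ?thesis
        using Y(2,3) by (intro bexI[of _ "Y \<inter> A (g t)"]) (auto simp: less_Suc_eq)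
    next
      \<comment> \<open>An index outside \<open>P\<close> takes the \<open>B\<close> side, including
        one that belongs to neither set.\<close>
      case False
      moreover have "Y \<inter> B (g t) \<in> \<Y> (Suc t)" using g Y(1) by blast
      ultimately show ?thesis
        using Y(2,3) by (intro bexI[of _ "Y \<inter> B (g t)"]) (auto simp: less_Suc_eq)
    qed
  qed
  have "indep_pairs UNIV UNIV (A \<circ> g) (B \<circ> g)"
    unfolding indep_pairs_def
  proof (intro allI impI; elim conjE)
    fix P Q :: "nat set" assume PQ: "finite P" "finite Q" "P \<inter> Q = {}"
    obtain t where t: "\<And>n. n \<in> P \<union> Q \<Longrightarrow> n < t"
      using PQ(1,2) by (metis finite_UnI finite_nat_set_iff_bounded)
    obtain Y where Y: "Y \<in> \<Y> t" "\<forall>n\<in>P. n < t \<longrightarrow> Y \<subseteq> A (g n)" "\<forall>n\<in>Q. n < t \<longrightarrow> Y \<subseteq> B (g n)"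
      using pat[OF PQ(3), of t] by blast
    obtain y where "y \<in> Y" using ne(2)[OF Y(1)] by blast
    then have "y \<in> UNIV \<inter> (\<Inter>n\<in>P. (A \<circ> g) n) \<inter> (\<Inter>n\<in>Q. (B \<circ> g) n)"
      using Y(2,3) t by auto
    then show "UNIV \<inter> (\<Inter>n\<in>P. (A \<circ> g) n) \<inter> (\<Inter>n\<in>Q. (B \<circ> g) n) \<noteq> {}" by blast
  qed
  then show ?thesis by (rule that)
qed

text \<open>The finitely many \<open>Y\<close> are treated one after another. Since \<open>R\<close>
  survives passing to smaller index sets, later shrinking does not spoil what was reached
  before.\<close>

lemma infinite_shrink_finite:
  assumes "finite \<X>" and "infinite N"
    and shrink: "\<And>Y M. Y \<in> \<X> \<Longrightarrow> M \<subseteq> N \<Longrightarrow> infinite M \<Longrightarrow> \<exists>M'\<subseteq>M. infinite M' \<and> R M' Y"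
    and mono: "\<And>Y M M'. R M Y \<Longrightarrow> M' \<subseteq> M \<Longrightarrow> R M' Y"
  shows "\<exists>M\<subseteq>N. infinite M \<and> (\<forall>Y\<in>\<X>. R M Y)"
  using assms(1) shrink
proof (induction \<X>)
  case empty
  then show ?case using assms(2) by blast
next
  case (insert Y \<X>)
  obtain M where M: "M \<subseteq> N" "infinite M" "\<forall>Y\<in>\<X>. R M Y"
    using insert.IH insert.prems by (meson insertCI)
  obtain M' where M': "M' \<subseteq> M" "infinite M'" "R M' Y"
    using insert.prems[of Y M] M by blast
  then show ?case using M mono by (intro exI[of _ M']) auto
qed

lemma indep_pairs_split2:
  fixes A B A1 A2 :: "nat \<Rightarrow> 'x set"
  assumes ind: "indep_pairs UNIV UNIV A B" and sub: "\<And>n. A n \<subseteq> A1 n \<union> A2 n"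
  shows "(\<exists>g. indep_pairs UNIV UNIV (A1 \<circ> g) (B \<circ> g)) \<or> (\<exists>g. indep_pairs UNIV UNIV (A2 \<circ> g) (B \<circ> g))"
proof -
  \<comment> \<open>\<open>bad X M\<close>: some \<open>n \<in> M\<close> can never be added to the \<open>A1\<close>-sequence while working inside \<open>X\<close>. If a single
    \<open>X0\<close> is bad for all infinite index sets, every such \<open>n\<close> can be added to the \<open>A2\<close>-sequence because of
    \<open>indep_pairs_Un\<close>; otherwise the greedy construction succeeds with \<open>A1\<close>.\<close>
  let ?I = "\<lambda>N X. indep_pairs N X A B"
  have ne: "Y \<noteq> {}" if "?I N Y" for N Y
    using indep_pairsD[OF that, of "{}" "{}"] by blast
  have mono: "?I N' Y" if "?I N Y" "N' \<subseteq> N" for N N' Y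
    using indep_pairs_mono[OF that] by blast
  have IntA: "?I (N - {n}) (Y \<inter> A n)" if "?I N Y" "n \<in> N" for N n Y
    using indep_pairs_Int[OF that] .
  have IntB: "?I (N - {n}) (Y \<inter> B n)" if "?I N Y" "n \<in> N" for N n Y
    using indep_pairs_sym[OF indep_pairs_Int[OF indep_pairs_sym[OF that(1)] that(2)]] .
  define bad where "bad = (\<lambda>X M. \<exists>n\<in>M. \<exists>M'\<subseteq>M. infinite M' \<and>
      (\<forall>M''\<subseteq>M'. infinite M'' \<longrightarrow> \<not> ?I M'' (X \<inter> A1 n)))"
  show ?thesis
  proof (cases "\<exists>X0 N0. infinite N0 \<and> ?I N0 X0 \<and> (\<forall>M\<subseteq>N0. infinite M \<longrightarrow> bad X0 M)")
    case True
    then obtain X0 N0 where 0: "infinite N0" "?I N0 X0"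
      and bad: "\<And>M. M \<subseteq> N0 \<Longrightarrow> infinite M \<Longrightarrow> bad X0 M" by blast
    define \<Phi> where "\<Phi> = (\<lambda>N Y. Y \<subseteq> X0 \<and> N \<subseteq> N0 \<and> ?I N Y)"
    obtain g where "indep_pairs UNIV UNIV (A2 \<circ> g) (B \<circ> g)"
    proof (rule indep_pairs_greedy[of \<Phi> A2 B N0 X0])
      fix \<X> N
      assume X: "finite \<X>" "\<X> \<noteq> {}" and N: "infinite N" and Phi: "\<And>Y. Y \<in> \<X> \<Longrightarrow> \<Phi> N Y"
      then have "N \<subseteq> N0" by (auto simp: \<Phi>_def)
      then obtain n M' where n: "n \<in> N" and M': "M' \<subseteq> N" "infinite M'"
        and no: "\<And>M''. M'' \<subseteq> M' \<Longrightarrow> infinite M'' \<Longrightarrow> \<not> ?I M'' (X0 \<inter> A1 n)"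
        using bad[of N] N unfolding bad_def by metis
      \<comment> \<open>Inside the live cell \<open>Y\<close> the set \<open>A n\<close> is covered
        by the two pieces. The \<open>A1\<close> piece is dead on every infinite part of
        \<open>M'\<close>, because the larger set \<open>X0 \<inter> A1 n\<close> already is; so the
        \<open>A2\<close> piece must be live off a finite set.\<close>
      have "\<exists>D. finite D \<and> ?I (M' - {n} - D) (Y \<inter> A2 n)" if Y: "Y \<in> \<X>" for Y
      proof -
        have "?I N Y" and YX: "Y \<subseteq> X0" using Phi[OF Y] by (auto simp: \<Phi>_def)
        then have "?I (N - {n}) (Y \<inter> A n)" using IntA n by blast
        then have "?I (M' - {n}) (Y \<inter> A n)" by (rule mono) (use M' in blast)
        then have "?I (M' - {n}) (Y \<inter> A1 n \<union> Y \<inter> A2 n)"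
          by (rule indep_pairs_mono) (use sub[of n] in blast)+
        moreover have "\<not> ?I (M' - {n}) (Y \<inter> A1 n)"
        proof
          assume "?I (M' - {n}) (Y \<inter> A1 n)"
          then have "?I (M' - {n}) (X0 \<inter> A1 n)"
            by (rule indep_pairs_mono) (use YX in blast)+
          then show False using no[of "M' - {n}"] M'(2) by auto
        qed
        ultimately show ?thesis by (metis indep_pairs_Un)
      qed
      then obtain D where D: "\<And>Y. Y \<in> \<X> \<Longrightarrow> finite (D Y)"
        "\<And>Y. Y \<in> \<X> \<Longrightarrow> ?I (M' - {n} - D Y) (Y \<inter> A2 n)" by metis
      \<comment> \<open>One reservoir for all cells: there are finitely many of them, and each costs
        finitely many indices.\<close>
      define N' where "N' = M' - {n} - (\<Union>Y\<in>\<X>. D Y)"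
      have "infinite N'"
      proof -
        have "finite ({n} \<union> (\<Union>Y\<in>\<X>. D Y))" using X(1) D(1) by auto
        moreover have "N' = M' - ({n} \<union> (\<Union>Y\<in>\<X>. D Y))" by (auto simp: N'_def)
        ultimately show ?thesis using M'(2) by (metis finite_Diff2)
      qed
      moreover have "\<Phi> N' (Y \<inter> A2 n) \<and> \<Phi> N' (Y \<inter> B n)" if Y: "Y \<in> \<X>" for Y
      proof -
        have Y': "?I N Y" "Y \<subseteq> X0" "N \<subseteq> N0" using Phi[OF Y] by (auto simp: \<Phi>_def)
        have "?I N' (Y \<inter> A2 n)" by (rule mono[OF D(2)[OF Y]]) (use Y in \<open>auto simp: N'_def\<close>)
        moreover have "?I N' (Y \<inter> B n)"
          by (rule mono[OF IntB[OF Y'(1) n]]) (use M' in \<open>auto simp: N'_def\<close>)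
        ultimately show ?thesis using Y' M'(1) by (auto simp: \<Phi>_def N'_def)
      qed
      ultimately show "\<exists>n N'. infinite N' \<and> (\<forall>Y\<in>\<X>. \<Phi> N' (Y \<inter> A2 n) \<and> \<Phi> N' (Y \<inter> B n))" by blast
    qed (use 0 ne in \<open>auto simp: \<Phi>_def\<close>)
    then show ?thesis by blast
  next
    case False
    have good: "\<exists>M\<subseteq>N. infinite M \<and> \<not> bad X M" if "infinite N" "?I N X" for X N
      using False that by blast
    have bad_mono: "\<not> bad X M'" if "\<not> bad X M" "M' \<subseteq> M" for X M M'
      using that unfolding bad_def by (meson subset_trans subsetD)
    obtain g where "indep_pairs UNIV UNIV (A1 \<circ> g) (B \<circ> g)"
    proof (rule indep_pairs_greedy[of ?I A1 B UNIV UNIV])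
      fix \<X> N
      assume X: "finite \<X>" and N: "infinite N" and I: "\<And>Y. Y \<in> \<X> \<Longrightarrow> ?I N Y"
      have "\<exists>M\<subseteq>N. infinite M \<and> (\<forall>Y\<in>\<X>. \<not> bad Y M)"
        by (rule infinite_shrink_finite[OF X N]) (use good I mono bad_mono in blast)+
      then obtain M where M: "M \<subseteq> N" "infinite M" "\<And>Y. Y \<in> \<X> \<Longrightarrow> \<not> bad Y M" by blast
      \<comment> \<open>Any \<open>n\<close> will do. No cell is \<open>bad\<close> on
        \<open>M\<close>, so no index of \<open>M\<close> is hereditarily dead for any of them, and
        further shrinking makes the same index serve all cells.\<close>
      obtain n where n: "n \<in> M" using M(2) by fastforce
      have "\<exists>N'\<subseteq>M - {n}. infinite N' \<and> (\<forall>Y\<in>\<X>. ?I N' (Y \<inter> A1 n))"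
      proof (rule infinite_shrink_finite[OF X])
        show "infinite (M - {n})" using M(2) by simp
        fix Y M' assume Y: "Y \<in> \<X>" and M': "M' \<subseteq> M - {n}" "infinite M'"
        have "M' \<subseteq> M" using M' by blast
        then show "\<exists>M''\<subseteq>M'. infinite M'' \<and> ?I M'' (Y \<inter> A1 n)"
          using M(3)[OF Y] n M'(2) unfolding bad_def by metis
      qed (use mono in blast)
      then obtain N' where N': "N' \<subseteq> M - {n}" "infinite N'" "\<forall>Y\<in>\<X>. ?I N' (Y \<inter> A1 n)" by blast
      moreover have "?I N' (Y \<inter> B n)" if "Y \<in> \<X>" for Y
        by (rule mono[OF IntB[OF I[OF that]]]) (use n M N' in auto)
      ultimately show "\<exists>n N'. infinite N' \<and> (\<forall>Y\<in>\<X>. ?I N' (Y \<inter> A1 n) \<and> ?I N' (Y \<inter> B n))" by blast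
    qed (use ind ne in auto)
    then show ?thesis by blast
  qed
qed

lemma indep_pairs_split:
  fixes A B :: "nat \<Rightarrow> 'x set" and A' :: "'c \<Rightarrow> nat \<Rightarrow> 'x set"
  assumes "finite C" "indep_pairs UNIV UNIV A B" "\<And>n. A n \<subseteq> (\<Union>c\<in>C. A' c n)"
  shows "\<exists>c\<in>C. \<exists>g. indep_pairs UNIV UNIV (A' c \<circ> g) (B \<circ> g)"
  using assms
proof (induction C arbitrary: A A' B)
  case empty
  \<comment> \<open>With no pieces every \<open>A n\<close> is empty, so the pattern
    \<open>{0}\<close>, \<open>{}\<close> cannot be realised.\<close>
  then show ?case using indep_pairsD[OF empty(1), of "{0}" "{}"] by auto
next
  case (insert c C)
  have cover: "A n \<subseteq> A' c n \<union> (\<Union>c\<in>C. A' c n)" for n using insert.prems(2)[of n] by auto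
  consider "\<exists>g. indep_pairs UNIV UNIV (A' c \<circ> g) (B \<circ> g)"
    | g where "indep_pairs UNIV UNIV ((\<lambda>n. \<Union>c\<in>C. A' c n) \<circ> g) (B \<circ> g)"
    using indep_pairs_split2[OF insert.prems(1), of "A' c" "\<lambda>n. \<Union>c\<in>C. A' c n", OF cover] by metis
  then show ?case
  proof cases
    case 1
    then show ?thesis by blast
  next
    case 2
    have "\<exists>c\<in>C. \<exists>h. indep_pairs UNIV UNIV ((\<lambda>n. A' c (g n)) \<circ> h) ((B \<circ> g) \<circ> h)"
      by (rule insert.IH[OF 2]) simp
    then obtain d h where "d \<in> C" "indep_pairs UNIV UNIV ((\<lambda>n. A' d (g n)) \<circ> h) ((B \<circ> g) \<circ> h)" by blast
    then have "indep_pairs UNIV UNIV (A' d \<circ> (g \<circ> h)) (B \<circ> (g \<circ> h))" by (simp add: comp_def)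
    then show ?thesis using \<open>d \<in> C\<close> by blast
  qed
qed

subsection \<open>Independent sequences of functions\<close>

lemma independent_seqI:
  assumes ind: "indep_pairs UNIV UNIV A B" and "a < b"
    and A: "\<And>n x. x \<in> A n \<Longrightarrow> x \<in> K \<and> f n x < a" and B: "\<And>n x. x \<in> B n \<Longrightarrow> x \<in> K \<and> b < f n x"
  shows "independent_seq K f"
  unfolding independent_seq_def
proof (rule exI[of _ a], rule exI[of _ b], intro conjI allI impI)
  fix P Q :: "nat set" assume PQ: "finite P \<and> finite Q \<and> P \<inter> Q = {}"
  \<comment> \<open>Both patterns may be empty, while membership in \<open>K\<close> is known only
    through \<open>A\<close> and \<open>B\<close>; a fresh index \<open>m\<close> forces it.\<close>
  obtain m where m: "m \<notin> P \<union> Q" using PQ by (metis ex_new_if_finite finite_UnI infinite_UNIV_nat)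
  obtain x where x: "\<And>n. n \<in> insert m P \<Longrightarrow> x \<in> A n" "\<And>n. n \<in> Q \<Longrightarrow> x \<in> B n"
    using indep_pairsD[OF ind, of "insert m P" Q] PQ m by auto
  then show "\<exists>x\<in>K. (\<forall>n\<in>P. f n x < a) \<and> (\<forall>n\<in>Q. b < f n x)"
    using A B by (meson insertCI)
qed fact

lemma independent_seqD:
  assumes "independent_seq K f"
  obtains a b where "a < b" "\<And>P Q. finite P \<and> finite Q \<and> P \<inter> Q = {} \<Longrightarrow>
      \<exists>x\<in>K. (\<forall>n\<in>P. f n x < a) \<and> (\<forall>n\<in>Q. b < f n x)"
proof -
  obtain a b where "a < b \<and> (\<forall>P Q. finite P \<and> finite Q \<and> P \<inter> Q = {} \<longrightarrow>
      (\<exists>x\<in>K. (\<forall>n\<in>P. f n x < a) \<and> (\<forall>n\<in>Q. b < f n x)))"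
    using assms unfolding independent_seq_def by (elim exE)
  then show ?thesis using that[of a b] by simp
qed

lemma independent_seqE:
  assumes "independent_seq K f"
  obtains a b where "a < b" "indep_pairs UNIV UNIV (\<lambda>n. {x\<in>K. f n x < a}) (\<lambda>n. {x\<in>K. b < f n x})"
proof -
  obtain a b where ab: "a < b" and i: "\<And>P Q. finite P \<and> finite Q \<and> P \<inter> Q = {} \<Longrightarrow>
      \<exists>x\<in>K. (\<forall>n\<in>P. f n x < a) \<and> (\<forall>n\<in>Q. b < f n x)"
    using independent_seqD[OF assms] by metis
  have "indep_pairs UNIV UNIV (\<lambda>n. {x\<in>K. f n x < a}) (\<lambda>n. {x\<in>K. b < f n x})"
    unfolding indep_pairs_def
  proof (intro allI impI)
    fix P Q :: "nat set"
    assume "finite P \<and> finite Q \<and> P \<inter> Q = {} \<and> P \<subseteq> UNIV \<and> Q \<subseteq> UNIV"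
    then show "UNIV \<inter> (\<Inter>n\<in>P. {x \<in> K. f n x < a}) \<inter> (\<Inter>n\<in>Q. {x \<in> K. b < f n x}) \<noteq> {}"
      using i[of P Q] by auto
  qed
  then show ?thesis using that ab by blast
qed

text \<open>Moves independence along a choice of extensions, along pullbacks and, with
  \<open>h\<close> the identity, between two formulas for the same values. Only the existence of
  points is transported, so \<open>h\<close> may be an arbitrary map.\<close>

lemma independent_seq_map:
  assumes "independent_seq K f" "h ` K \<subseteq> K'" "\<And>n x. x \<in> K \<Longrightarrow> f' n (h x) = f n x"
  shows "independent_seq K' f'"
proof -
  obtain a b where ab: "a < b" and i: "\<And>P Q. finite P \<and> finite Q \<and> P \<inter> Q = {} \<Longrightarrow>
      \<exists>x\<in>K. (\<forall>n\<in>P. f n x < a) \<and> (\<forall>n\<in>Q. b < f n x)"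
    using independent_seqD[OF assms(1)] by metis
  show ?thesis unfolding independent_seq_def
  proof (rule exI[of _ a], rule exI[of _ b], intro conjI allI impI)
    fix P Q :: "nat set" assume "finite P \<and> finite Q \<and> P \<inter> Q = {}"
    then have "\<exists>x\<in>K. (\<forall>n\<in>P. f n x < a) \<and> (\<forall>n\<in>Q. b < f n x)" by (rule i)
    then obtain x where "x \<in> K" "\<forall>n\<in>P. f n x < a" "\<forall>n\<in>Q. b < f n x" by blast
    then show "\<exists>x\<in>K'. (\<forall>n\<in>P. f' n x < a) \<and> (\<forall>n\<in>Q. b < f' n x)"
      using assms(2,3) by (intro bexI[of _ "h x"]) auto
  qed fact
qed

text \<open>Once the low sets are confined to one cell \<open>k\<close> of \<open>f\<close> and the
  high sets to one cell \<open>l\<close>, the rise of \<open>f\<close> from low to high is known up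
  to cell width. Either it is bounded away from 0, or it is less than half of the gap and
  \<open>g\<close> must supply the rest. The bound on \<open>f\<close> makes the number of cells
  finite.\<close>

lemma independent_seq_add:
  fixes f g :: "nat \<Rightarrow> 'x \<Rightarrow> real"
  assumes ind: "independent_seq K (\<lambda>n x. f n x + g n x)"
    and bound: "\<And>n x. x \<in> K \<Longrightarrow> \<bar>f n x\<bar> \<le> M"
  shows "\<exists>r. independent_seq K (f \<circ> r) \<or> independent_seq K (g \<circ> r)"
proof -
  obtain a b where ab: "a < b" and i: "indep_pairs UNIV UNIV
      (\<lambda>n. {x\<in>K. f n x + g n x < a}) (\<lambda>n. {x\<in>K. b < f n x + g n x})"
    using independent_seqE[OF ind] .
  \<comment> \<open>A quarter of the gap: a rise of \<open>f\<close> by two cells uses up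
    \<open>2 * e\<close> and leaves \<open>2 * e\<close> for \<open>g\<close>.\<close>
  define e where "e = (b - a) / 4"
  have e: "e > 0" using ab by (simp add: e_def)
  define cell where "cell = (\<lambda>n x. \<lfloor>f n x / e\<rfloor>)"
  have cell: "e * cell n x \<le> f n x" "f n x < e * (cell n x + 1)" for n x
    using e floor_divide_lower[OF e, of "f n x"] floor_divide_upper[OF e, of "f n x"]
    by (simp_all add: cell_def mult.commute)
  define C where "C = {\<lfloor>- M / e\<rfloor>..\<lfloor>M / e\<rfloor>}"
  have C: "finite C" "\<And>n x. x \<in> K \<Longrightarrow> cell n x \<in> C"
  proof -
    fix n x assume "x \<in> K"
    then have "- M \<le> f n x" "f n x \<le> M" using bound[of x n] by auto
    then have "- M / e \<le> f n x / e" "f n x / e \<le> M / e"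
      using e by (intro divide_right_mono; simp)+
    then show "cell n x \<in> C" unfolding C_def cell_def by (auto intro: floor_mono simp del: minus_divide_left)
  qed (simp add: C_def)
  have cov1: "{x\<in>K. f n x + g n x < a} \<subseteq> (\<Union>k\<in>C. {x\<in>K. f n x + g n x < a \<and> cell n x = k})" for n
    using C(2) by blast
  obtain k r1 where 1: "indep_pairs UNIV UNIV ((\<lambda>n. {x\<in>K. f n x + g n x < a \<and> cell n x = k}) \<circ> r1)
      ((\<lambda>n. {x\<in>K. b < f n x + g n x}) \<circ> r1)"
    using indep_pairs_split[OF C(1) i cov1] by blast
  have cov2: "((\<lambda>n. {x\<in>K. b < f n x + g n x}) \<circ> r1) n
      \<subseteq> (\<Union>l\<in>C. {x\<in>K. b < f (r1 n) x + g (r1 n) x \<and> cell (r1 n) x = l})" for n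
    unfolding comp_def using C(2) by blast
  \<comment> \<open>Splitting acts on the first member of the pairs, so the two sides are exchanged
    before the high sets are cut. The low sets keep their cell \<open>k\<close> under further
    reindexing.\<close>
  obtain l r2 where 2: "indep_pairs UNIV UNIV
      ((\<lambda>n. {x\<in>K. b < f (r1 n) x + g (r1 n) x \<and> cell (r1 n) x = l}) \<circ> r2)
      (((\<lambda>n. {x\<in>K. f n x + g n x < a \<and> cell n x = k}) \<circ> r1) \<circ> r2)"
    using indep_pairs_split[OF C(1) indep_pairs_sym[OF 1] cov2] by blast
  define r where "r = r1 \<circ> r2"
  have 3: "indep_pairs UNIV UNIV (\<lambda>n. {x\<in>K. f (r n) x + g (r n) x < a \<and> cell (r n) x = k})
     (\<lambda>n. {x\<in>K. b < f (r n) x + g (r n) x \<and> cell (r n) x = l})"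
    using indep_pairs_sym[OF 2] by (simp add: r_def comp_def)
  show ?thesis
  proof (cases "k + 2 \<le> l")
    case True
    have le: "e * (k + 2) \<le> e * l" using e True by (intro mult_left_mono) linarith+
    have "independent_seq K (f \<circ> r)"
    proof (rule independent_seqI[OF 3])
      \<comment> \<open>On the high sets only the weak inequality \<open>e * l \<le> f\<close> is
        known, so the upper threshold is placed strictly below \<open>e * (k + 2)\<close>.\<close>
      show "e * (k + 1) < e * (k + 3/2)" using e by simp
      fix n x
      { assume "x \<in> {x\<in>K. f (r n) x + g (r n) x < a \<and> cell (r n) x = k}"
        then show "x \<in> K \<and> (f \<circ> r) n x < e * (k + 1)" using cell(2)[of "r n" x] by auto }
      { assume "x \<in> {x\<in>K. b < f (r n) x + g (r n) x \<and> cell (r n) x = l}"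
        then have "x \<in> K" "e * l \<le> f (r n) x" using cell(1)[of "r n" x] by auto
        moreover have "e * (k + 3/2) < e * (k + 2)" using e by simp
        ultimately show "x \<in> K \<and> e * (k + 3/2) < (f \<circ> r) n x" using le by (auto simp: comp_def) }
    qed
    then show ?thesis by blast
  next
    case False
    then have "l + 1 \<le> k + 2" by simp
    then have le: "e * (l + 1) \<le> e * (k + 2)" using e by (intro mult_left_mono) linarith+
    have "independent_seq K (g \<circ> r)"
    proof (rule independent_seqI[OF 3])
      \<comment> \<open>On the low sets \<open>f\<close> is at least \<open>e * k\<close>, on the
        high sets it is below \<open>e * (k + 2)\<close>. Subtracting these from the thresholds of
        the sum gives thresholds for \<open>g\<close>.\<close>
      show "a - e * k < b - e * (k + 2)" using e by (simp add: e_def field_simps)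
      fix n x
      { assume "x \<in> {x\<in>K. f (r n) x + g (r n) x < a \<and> cell (r n) x = k}"
        then show "x \<in> K \<and> (g \<circ> r) n x < a - e * k" using cell(1)[of "r n" x] by auto }
      { assume "x \<in> {x\<in>K. b < f (r n) x + g (r n) x \<and> cell (r n) x = l}"
        then have "x \<in> K" "f (r n) x < e * (l + 1)" "b < f (r n) x + g (r n) x"
          using cell(2)[of "r n" x] by auto
        then show "x \<in> K \<and> b - e * (k + 2) < (g \<circ> r) n x" using le by auto }
    qed
    then show ?thesis by blast
  qed
qed

lemma independent_seq_sum:
  fixes f :: "'i \<Rightarrow> nat \<Rightarrow> 'x \<Rightarrow> real"
  assumes "finite J" "independent_seq K (\<lambda>n x. \<Sum>i\<in>J. f i n x)"
    and "\<And>i. i \<in> J \<Longrightarrow> \<exists>M. \<forall>n. \<forall>x\<in>K. \<bar>f i n x\<bar> \<le> M"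
  shows "\<exists>i\<in>J. \<exists>r. independent_seq K (f i \<circ> r)"
  using assms
proof (induction J arbitrary: f)
  case empty
  obtain a b :: real where "a < b" and i: "\<And>P Q :: nat set. finite P \<and> finite Q \<and> P \<inter> Q = {} \<Longrightarrow>
      \<exists>x\<in>K. (\<forall>n\<in>P. (\<Sum>i\<in>{}. f i n x) < a) \<and> (\<forall>n\<in>Q. b < (\<Sum>i\<in>{}. f i n x))"
    using independent_seqD[OF empty.prems(1)] by metis
  \<comment> \<open>The empty sum is 0, so this pattern yields \<open>0 < a\<close> and
    \<open>b < 0\<close>.\<close>
  have "\<exists>x\<in>K. (\<forall>n\<in>{0::nat}. (\<Sum>i\<in>{}. f i n x) < a) \<and> (\<forall>n\<in>{1::nat}. b < (\<Sum>i\<in>{}. f i n x))"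
    by (rule i) simp
  then show ?case using \<open>a < b\<close> by auto
next
  case (insert j J)
  have "independent_seq K (\<lambda>n x. f j n x + (\<Sum>i\<in>J. f i n x))" using insert by simp
  moreover obtain M where "\<forall>n. \<forall>x\<in>K. \<bar>f j n x\<bar> \<le> M" using insert.prems(2)[of j] by auto
  ultimately obtain r where
    "independent_seq K (f j \<circ> r) \<or> independent_seq K ((\<lambda>n x. \<Sum>i\<in>J. f i n x) \<circ> r)"
    using independent_seq_add[of K "f j" "\<lambda>n x. \<Sum>i\<in>J. f i n x" M] by blast
  then show ?case
  proof
    assume "independent_seq K ((\<lambda>n x. \<Sum>i\<in>J. f i n x) \<circ> r)"
    then have "independent_seq K (\<lambda>n x. \<Sum>i\<in>J. f i (r n) x)" by (simp add: comp_def)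
    moreover have "\<exists>M. \<forall>n. \<forall>x\<in>K. \<bar>f i (r n) x\<bar> \<le> M" if "i \<in> J" for i
      using insert.prems(2)[of i] that by blast
    ultimately obtain i s where "i \<in> J" "independent_seq K ((\<lambda>n. f i (r n)) \<circ> s)"
      using insert.IH[of "\<lambda>i n. f i (r n)"] by blast
    then have "independent_seq K (f i \<circ> (r \<circ> s))" by (simp add: comp_def)
    then show ?thesis using \<open>i \<in> J\<close> by blast
  qed blast
qed

subsection \<open>Linear functionals dominated by seminorms\<close>

definition linear_functional_on :: "'a::real_vector set \<Rightarrow> ('a \<Rightarrow> real) \<Rightarrow> bool" where
  "linear_functional_on S \<phi> \<longleftrightarrow> (\<forall>x\<in>S. \<forall>y\<in>S. \<phi> (x + y) = \<phi> x + \<phi> y) \<and> (\<forall>c. \<forall>x\<in>S. \<phi> (c *\<^sub>R x) = c * \<phi> x)"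

text \<open>Homogeneity is demanded only as an inequality for positive factors, a form that is
  easily checked for infima. Equality follows by using the inverse factor, and the value at 0 is
  derived.\<close>

definition sublinear_on :: "'a::real_vector set \<Rightarrow> ('a \<Rightarrow> real) \<Rightarrow> bool" where
  "sublinear_on S r \<longleftrightarrow> (\<forall>x\<in>S. \<forall>y\<in>S. r (x + y) \<le> r x + r y) \<and> (\<forall>c>0. \<forall>x\<in>S. r (c *\<^sub>R x) \<le> c * r x)"

lemma sublinear_on_0:
  assumes "subspace S" "sublinear_on S r"
  shows "r 0 = 0"
proof -
  have "0 \<in> S" using assms(1) by (rule subspace_0)
  then have "r (0 + 0) \<le> r 0 + r 0"
    using assms(2) unfolding sublinear_on_def by blast
  moreover have "r (c *\<^sub>R 0) \<le> c * r 0" if "0 < c" for c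
    using assms(2) \<open>0 \<in> S\<close> that unfolding sublinear_on_def by blast
  from this[of "1/2"] have "r 0 \<le> r 0 / 2" by simp
  ultimately show ?thesis by simp
qed

lemma sublinear_on_lower:
  assumes "subspace S" "sublinear_on S r" "x \<in> S"
  shows "- r (- x) \<le> r x"
proof -
  have "r (x + - x) \<le> r x + r (- x)"
    using assms subspace_neg[OF assms(1,3)] unfolding sublinear_on_def by blast
  then show ?thesis using sublinear_on_0[OF assms(1,2)] by simp
qed

text \<open>The witness \<open>r'\<close> is an infimal convolution of \<open>r\<close> with
  \<open>l\<close>: it lowers \<open>r\<close> so that \<open>- l d\<close> bounds it at
  \<open>- d\<close>. It serves twice, with \<open>D\<close> a half-line to show that a minimal
  functional is odd, and with \<open>D\<close> a subspace to build in a prescribed functional; hence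
  \<open>D\<close> is a cone.\<close>

lemma sublinear_on_reduce:
  assumes S: "subspace S" and r: "sublinear_on S r" and D: "D \<subseteq> S" "0 \<in> D"
    and Dadd: "\<And>d e. d \<in> D \<Longrightarrow> e \<in> D \<Longrightarrow> d + e \<in> D" and Dscale: "\<And>c d. 0 < c \<Longrightarrow> d \<in> D \<Longrightarrow> c *\<^sub>R d \<in> D"
    and ladd: "\<And>d e. d \<in> D \<Longrightarrow> e \<in> D \<Longrightarrow> l (d + e) = l d + l e"
    and lscale: "\<And>c d. 0 < c \<Longrightarrow> d \<in> D \<Longrightarrow> l (c *\<^sub>R d) = c * l d"
    and le: "\<And>d. d \<in> D \<Longrightarrow> l d \<le> r d"
  obtains r' where "sublinear_on S r'" "\<And>x. x \<in> S \<Longrightarrow> r' x \<le> r x"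
    "\<And>d. d \<in> D \<Longrightarrow> r' (- d) \<le> - l d" "\<And>x. x \<notin> S \<Longrightarrow> r' x = 0"
proof -
  define r' where "r' = (\<lambda>x. if x \<in> S then INF d\<in>D. r (x + d) - l d else 0)"
  have radd: "r (x + y) \<le> r x + r y" if "x \<in> S" "y \<in> S" for x y
    using r that unfolding sublinear_on_def by blast
  have rscale: "r (c *\<^sub>R x) \<le> c * r x" if "x \<in> S" "0 < c" for x c
    using r that unfolding sublinear_on_def by blast
  have l0: "l 0 = 0" using ladd[OF D(2) D(2)] by simp
  have bdd: "bdd_below ((\<lambda>d. r (x + d) - l d) ` D)" if x: "x \<in> S" for x
  proof (rule bdd_belowI2)
    fix d assume d: "d \<in> D"
    \<comment> \<open>Writing \<open>d\<close> as \<open>(x + d) - x\<close> turns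
      \<open>l d \<le> r d\<close> into a lower bound that does not depend on
      \<open>d\<close>.\<close>
    have "r ((x + d) + - x) \<le> r (x + d) + r (- x)"
      by (rule radd) (use x d D S in \<open>auto intro: subspace_add subspace_neg\<close>)
    then show "- r (- x) \<le> r (x + d) - l d" using le[OF d] by simp
  qed
  have lower: "r' x \<le> r (x + d) - l d" if "x \<in> S" "d \<in> D" for x d
    using cINF_lower[OF bdd that(2)] that unfolding r'_def by simp
  have greatest: "m \<le> r' x" if "x \<in> S" "\<And>d. d \<in> D \<Longrightarrow> m \<le> r (x + d) - l d" for x m
    unfolding r'_def using that cINF_greatest[of D m "\<lambda>d. r (x + d) - l d"] D(2) by auto
  show ?thesis
  proof (rule that)
    show "sublinear_on S r'"
      unfolding sublinear_on_def
    proof (intro conjI ballI allI impI)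
      fix x y assume x: "x \<in> S" and y: "y \<in> S"
      then have xy: "x + y \<in> S" using S by (simp add: subspace_add)
      have "r' (x + y) - r' x \<le> r (y + e) - l e" if e: "e \<in> D" for e
      proof -
        have "r' (x + y) - (r (y + e) - l e) \<le> r (x + d) - l d" if d: "d \<in> D" for d
        proof -
          have "r' (x + y) \<le> r (x + y + (d + e)) - l (d + e)" using lower[OF xy Dadd[OF d e]] .
          also have "x + y + (d + e) = (x + d) + (y + e)" by simp
          also have "r ((x + d) + (y + e)) \<le> r (x + d) + r (y + e)"
            by (rule radd) (use x y d e D S in \<open>auto intro: subspace_add\<close>)
          finally show ?thesis using ladd[OF d e] by simp
        qed
        then have "r' (x + y) - (r (y + e) - l e) \<le> r' x" by (rule greatest[OF x])
        then show ?thesis by simp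
      qed
      then have "r' (x + y) - r' x \<le> r' y" by (rule greatest[OF y])
      then show "r' (x + y) \<le> r' x + r' y" by simp
    next
      fix c :: real and x assume c: "0 < c" and x: "x \<in> S"
      then have cx: "c *\<^sub>R x \<in> S" using S by (simp add: subspace_scale)
      have "r' (c *\<^sub>R x) / c \<le> r (x + d) - l d" if d: "d \<in> D" for d
      proof -
        have "r' (c *\<^sub>R x) \<le> r (c *\<^sub>R x + c *\<^sub>R d) - l (c *\<^sub>R d)" using lower[OF cx Dscale[OF c d]] .
        also have "c *\<^sub>R x + c *\<^sub>R d = c *\<^sub>R (x + d)" by (simp add: scaleR_add_right)
        also have "r (c *\<^sub>R (x + d)) \<le> c * r (x + d)"
          by (rule rscale) (use x d D S c in \<open>auto intro: subspace_add\<close>)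
        finally show ?thesis using lscale[OF c d] c by (simp add: field_simps)
      qed
      then have "r' (c *\<^sub>R x) / c \<le> r' x" by (rule greatest[OF x])
      then show "r' (c *\<^sub>R x) \<le> c * r' x" using c by (simp add: field_simps)
    qed
  next
    fix x assume "x \<in> S" then show "r' x \<le> r x" using lower[of x 0] D(2) l0 by simp
  next
    fix d assume d: "d \<in> D"
    then have "- d \<in> S" using D S by (auto intro: subspace_neg)
    then show "r' (- d) \<le> - l d" using lower[of "- d" d] d sublinear_on_0[OF S r] by simp
  qed (simp add: r'_def)
qed

text \<open>A minimal sublinear functional below \<open>p\<close> is odd, and an odd sublinear
  functional is linear. Minimality replaces the usual extension by one dimension.\<close>

lemma linear_functional_below_sublinear:
  assumes S: "subspace S" and p: "sublinear_on S p"
  obtains r where "linear_functional_on S r" "\<And>x. x \<in> S \<Longrightarrow> r x \<le> p x" "\<And>x. x \<notin> S \<Longrightarrow> r x = 0"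
proof -
  define Q where "Q = {r. sublinear_on S r \<and> (\<forall>x\<in>S. r x \<le> p x) \<and> (\<forall>x. x \<notin> S \<longrightarrow> r x = 0)}"
  \<comment> \<open>The order is reversed because \<open>predicate_Zorn\<close> yields maximal
    elements.\<close>
  define below where "below = (\<lambda>(a::'a \<Rightarrow> real) b. b \<le> a)"
  have "\<exists>m\<in>Q. \<forall>a\<in>Q. below m a \<longrightarrow> a = m"
  proof (rule predicate_Zorn)
    show "partial_order_on Q (relation_of below Q)"
      by (rule partial_order_on_relation_ofI) (auto simp: below_def)
    fix C assume C: "C \<in> Chains (relation_of below Q)"
    then have CQ: "C \<subseteq> Q" and chain: "\<And>a b. a \<in> C \<Longrightarrow> b \<in> C \<Longrightarrow> a \<le> b \<or> b \<le> a"
      unfolding Chains_def relation_of_def below_def by blast+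
    show "\<exists>u\<in>Q. \<forall>a\<in>C. below a u"
    proof (cases "C = {}")
      case True
      have "(\<lambda>x. if x \<in> S then p x else 0) \<in> Q"
        using p S unfolding Q_def sublinear_on_def by (auto simp: subspace_add subspace_scale)
      then show ?thesis using True by blast
    next
      case False
      define u where "u = (\<lambda>x. INF r\<in>C. r x)"
      have bdd: "bdd_below ((\<lambda>r. r x) ` C)" for x
      proof (rule bdd_belowI2)
        fix r assume "r \<in> C"
        then have r: "sublinear_on S r" "\<forall>x\<in>S. r x \<le> p x" "x \<notin> S \<Longrightarrow> r x = 0"
          using CQ unfolding Q_def by auto
        show "(if x \<in> S then - p (- x) else 0) \<le> r x"
        proof (cases "x \<in> S")
          case True
          then have "r (- x) \<le> p (- x)" using r(2) S by (simp add: subspace_neg)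
          then show ?thesis using sublinear_on_lower[OF S r(1) True] True by simp
        qed (use r(3) in simp)
      qed
      have lower: "u x \<le> r x" if "r \<in> C" for r x
        unfolding u_def by (rule cINF_lower[OF bdd that])
      have greatest: "m \<le> u x" if "\<And>r. r \<in> C \<Longrightarrow> m \<le> r x" for m x
        unfolding u_def using False that by (rule cINF_greatest)
      obtain r0 where r0: "r0 \<in> C" using False by blast
      have "u \<in> Q"
        unfolding Q_def sublinear_on_def
      proof (intro CollectI conjI ballI allI impI)
        fix x y assume x: "x \<in> S" and y: "y \<in> S"
        have "u (x + y) - u x \<le> r y" if r: "r \<in> C" for r
        proof -
          have "u (x + y) - r y \<le> s x" if s: "s \<in> C" for s
          proof -
            \<comment> \<open>The smaller of \<open>r\<close> and \<open>s\<close> in the chain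
              serves both arguments, so its subadditivity can be applied.\<close>
            obtain t where t: "t \<in> C" "t x \<le> s x" "t y \<le> r y"
              using chain[OF r s] r s by (auto simp: le_fun_def)
            have "u (x + y) \<le> t (x + y)" using lower t(1) .
            also have "\<dots> \<le> t x + t y" using t(1) CQ x y unfolding Q_def sublinear_on_def by blast
            finally show ?thesis using t by simp
          qed
          then have "u (x + y) - r y \<le> u x" by (rule greatest)
          then show ?thesis by simp
        qed
        then have "u (x + y) - u x \<le> u y" by (rule greatest)
        then show "u (x + y) \<le> u x + u y" by simp
      next
        fix c :: real and x assume c: "0 < c" and x: "x \<in> S"
        have "u (c *\<^sub>R x) / c \<le> r x" if r: "r \<in> C" for r
        proof -
          have "u (c *\<^sub>R x) \<le> r (c *\<^sub>R x)" using lower r .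
          also have "\<dots> \<le> c * r x" using r CQ x c unfolding Q_def sublinear_on_def by blast
          finally show ?thesis using c by (simp add: field_simps)
        qed
        then have "u (c *\<^sub>R x) / c \<le> u x" by (rule greatest)
        then show "u (c *\<^sub>R x) \<le> c * u x" using c by (simp add: field_simps)
      next
        fix x assume "x \<in> S"
        then have "r0 x \<le> p x" using r0 CQ unfolding Q_def by blast
        then show "u x \<le> p x" using lower[OF r0, of x] by linarith
      next
        fix x assume "x \<notin> S"
        then have "r x = 0" if "r \<in> C" for r using that CQ unfolding Q_def by blast
        then show "u x = 0" using lower[OF r0, of x] greatest[of 0 x] r0 by force
      qed
      then show ?thesis using lower unfolding below_def le_fun_def by blast
    qed
  qed
  then obtain r where r: "r \<in> Q" and min: "\<And>a. a \<in> Q \<Longrightarrow> a \<le> r \<Longrightarrow> a = r"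
    unfolding below_def by blast
  have sub: "sublinear_on S r" and rp: "\<And>x. x \<in> S \<Longrightarrow> r x \<le> p x" and off: "\<And>x. x \<notin> S \<Longrightarrow> r x = 0"
    using r unfolding Q_def by auto
  have r0: "r 0 = 0" using sublinear_on_0[OF S sub] .
  have radd: "r (x + y) \<le> r x + r y" if "x \<in> S" "y \<in> S" for x y
    using sub that unfolding sublinear_on_def by blast
  have rscale: "r (c *\<^sub>R x) = c * r x" if x: "x \<in> S" and c: "0 < c" for x c
  proof (rule antisym)
    show "r (c *\<^sub>R x) \<le> c * r x" using sub that unfolding sublinear_on_def by blast
    have "r (inverse c *\<^sub>R (c *\<^sub>R x)) \<le> inverse c * r (c *\<^sub>R x)"
      using sub c subspace_scale[OF S x, of c] unfolding sublinear_on_def by (metis positive_imp_inverse_positive)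
    then show "c * r x \<le> r (c *\<^sub>R x)" using c by (simp add: field_simps)
  qed
  have neg: "r (- y) = - r y" if y: "y \<in> S" for y
  proof -
    \<comment> \<open>On the half-line through \<open>y\<close> the functional \<open>r\<close> is
      itself additive, so it may be reduced along it; minimality then forces
      \<open>r (- y) \<le> - r y\<close>.\<close>
    define D where "D = {t *\<^sub>R y | t. 0 \<le> t}"
    have DS: "D \<subseteq> S" using y S by (auto simp: D_def subspace_scale)
    have rD: "r (t *\<^sub>R y) = t * r y" if "0 \<le> t" for t
      using rscale[OF y, of t] that r0 by (cases "t = 0") auto
    obtain r' where r': "sublinear_on S r'" "\<And>x. x \<in> S \<Longrightarrow> r' x \<le> r x"
      "\<And>d. d \<in> D \<Longrightarrow> r' (- d) \<le> - r d" "\<And>x. x \<notin> S \<Longrightarrow> r' x = 0"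
    proof (rule sublinear_on_reduce[OF S sub DS])
      show "0 \<in> D" unfolding D_def by (intro CollectI exI[of _ 0]) simp
      fix d e assume "d \<in> D" "e \<in> D"
      then obtain s t where st: "d = s *\<^sub>R y" "e = t *\<^sub>R y" "0 \<le> s" "0 \<le> t" unfolding D_def by blast
      then have de: "d + e = (s + t) *\<^sub>R y" by (simp add: scaleR_add_left)
      then show "d + e \<in> D" unfolding D_def using st by (intro CollectI exI[of _ "s + t"]) simp
      show "r (d + e) = r d + r e" unfolding de using st(3,4) by (simp add: st(1,2) rD distrib_right)
    next
      fix c :: real and d assume "0 < c" "d \<in> D"
      then obtain s where s: "d = s *\<^sub>R y" "0 \<le> s" unfolding D_def by blast
      then show "c *\<^sub>R d \<in> D" unfolding D_def using \<open>0 < c\<close> by (intro CollectI exI[of _ "c * s"]) simp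
      show "r (c *\<^sub>R d) = c * r d" by (rule rscale) (use \<open>0 < c\<close> \<open>d \<in> D\<close> DS in auto)
    qed auto
    have "r' x \<le> p x" if "x \<in> S" for x using r'(2)[OF that] rp[OF that] by linarith
    then have "r' \<in> Q" using r'(1,4) unfolding Q_def by blast
    moreover have "r' \<le> r" unfolding le_fun_def using r'(2,4) off by (metis order_refl)
    ultimately have "r' = r" by (rule min)
    moreover have "y \<in> D" unfolding D_def by (intro CollectI exI[of _ 1]) simp
    ultimately have "r (- y) \<le> - r y" using r'(3) by blast
    then show ?thesis using sublinear_on_lower[OF S sub y] by simp
  qed
  have "linear_functional_on S r"
    unfolding linear_functional_on_def
  proof (intro conjI ballI allI)
    fix x y assume x: "x \<in> S" and y: "y \<in> S"
    then have "r ((x + y) + - y) \<le> r (x + y) + r (- y)"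
      using S by (intro radd) (auto intro: subspace_add subspace_neg)
    then show "r (x + y) = r x + r y" using neg[OF y] radd[OF x y] by simp
  next
    fix c :: real and x assume x: "x \<in> S"
    consider "c > 0" | "c = 0" | "c < 0" by linarith
    then show "r (c *\<^sub>R x) = c * r x"
    proof cases
      case 3
      have "r (c *\<^sub>R x) = - r (- (c *\<^sub>R x))" using neg[OF subspace_scale[OF S x, of c]] by simp
      also have "- (c *\<^sub>R x) = (- c) *\<^sub>R x" by simp
      also have "r ((- c) *\<^sub>R x) = - c * r x" using rscale[OF x, of "- c"] 3 by simp
      finally show ?thesis by simp
    qed (use rscale[OF x] r0 in auto)
  qed
  then show ?thesis using rp off that by blast
qed

section \<open>Hahn-Banach and Banach-Alaoglu for a seminorm\<close>

lemma linear_functional_on_minus: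
  "linear_functional_on S \<phi> \<Longrightarrow> x \<in> S \<Longrightarrow> \<phi> (- x) = - \<phi> x"
  unfolding linear_functional_on_def by (metis minus_one_mult_self mult_minus1 scaleR_minus1_left)

text \<open>\<open>q\<close> is first lowered along \<open>L\<close> by \<open>\<phi>\<close>. Every
  linear functional below the result then agrees with \<open>\<phi>\<close> on \<open>L\<close>,
  because \<open>L\<close> contains negatives, so any linear minorant is an extension.\<close>

theorem Hahn_Banach_seminorm_on:
  assumes S: "subspace S" and q: "seminorm_on S q" and L: "subspace L" "L \<subseteq> S"
    and \<phi>: "linear_functional_on L \<phi>" and le: "\<And>x. x \<in> L \<Longrightarrow> \<bar>\<phi> x\<bar> \<le> q x"
  obtains \<psi> where "linear_functional_on S \<psi>" "\<And>x. x \<in> S \<Longrightarrow> \<bar>\<psi> x\<bar> \<le> q x"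
    "\<And>x. x \<in> L \<Longrightarrow> \<psi> x = \<phi> x" "\<And>x. x \<notin> S \<Longrightarrow> \<psi> x = 0"
proof -
  have q': "sublinear_on S q" and qneg: "\<And>x. x \<in> S \<Longrightarrow> q (- x) = q x"
  proof -
    show "sublinear_on S q" using q unfolding seminorm_on_def sublinear_on_def by simp
    fix x assume "x \<in> S"
    then have "q ((- 1) *\<^sub>R x) = \<bar>- 1\<bar> * q x" using q unfolding seminorm_on_def by blast
    then show "q (- x) = q x" by simp
  qed
  obtain p where p: "sublinear_on S p" "\<And>x. x \<in> S \<Longrightarrow> p x \<le> q x" "\<And>d. d \<in> L \<Longrightarrow> p (- d) \<le> - \<phi> d"
  proof (rule sublinear_on_reduce[OF S q' L(2) subspace_0[OF L(1)]])
    show "\<phi> d \<le> q d" if "d \<in> L" for d using le[OF that] by simp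
  qed (use \<phi> L(1) in \<open>auto simp: linear_functional_on_def subspace_add subspace_scale\<close>)
  obtain \<psi> where \<psi>: "linear_functional_on S \<psi>" "\<And>x. x \<in> S \<Longrightarrow> \<psi> x \<le> p x" "\<And>x. x \<notin> S \<Longrightarrow> \<psi> x = 0"
    using linear_functional_below_sublinear[OF S p(1)] by blast
  have "\<bar>\<psi> x\<bar> \<le> q x" if x: "x \<in> S" for x
  proof -
    have "- x \<in> S" using S x by (rule subspace_neg)
    then have "\<psi> (- x) \<le> q x" using \<psi>(2) p(2) qneg[OF x] order_trans by metis
    moreover have "\<psi> x \<le> q x" using \<psi>(2) p(2) x order_trans by metis
    ultimately show ?thesis using linear_functional_on_minus[OF \<psi>(1) x] by simp
  qed
  moreover have "\<psi> x = \<phi> x" if x: "x \<in> L" for x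
  proof -
    have *: "- \<psi> y \<le> - \<phi> y" if y: "y \<in> L" for y
    proof -
      have "y \<in> S" "- y \<in> S" using y L S by (auto intro: subspace_neg)
      then show ?thesis using \<psi>(2)[of "- y"] p(3)[OF y] linear_functional_on_minus[OF \<psi>(1)] by fastforce
    qed
    have "\<psi> (- x) = - \<psi> x" using linear_functional_on_minus[OF \<psi>(1)] x L(2) by blast
    moreover have "\<phi> (- x) = - \<phi> x" using linear_functional_on_minus[OF \<phi> x] .
    ultimately show ?thesis using *[OF x] *[OF subspace_neg[OF L(1) x]] by simp
  qed
  ultimately show ?thesis using that \<psi> by blast
qed

text \<open>Linearity cuts a closed set out of a product of compact intervals. The factor
  \<open>{0}\<close> off \<open>S\<close> keeps the product over the whole type compact.\<close>

theorem Banach_Alaoglu_seminorm_on: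
  "compact {\<psi>. linear_functional_on S \<psi> \<and> (\<forall>x\<in>S. \<bar>\<psi> x\<bar> \<le> q x) \<and> (\<forall>x. x \<notin> S \<longrightarrow> \<psi> x = 0)}"
proof -
  define K0 where "K0 = PiE UNIV (\<lambda>x. if x \<in> S then {- q x..q x} else {0::real})"
  have "compactin (product_topology (\<lambda>i. euclidean) UNIV) K0"
    unfolding K0_def compactin_PiE by auto
  then have K0: "compact K0" by (simp add: euclidean_product_topology)
  define Z where "Z = (\<Inter>x\<in>S. \<Inter>y\<in>S. {\<psi>::'a \<Rightarrow> real. \<psi> (x + y) = \<psi> x + \<psi> y})
      \<inter> (\<Inter>c. \<Inter>x\<in>S. {\<psi>. \<psi> (c *\<^sub>R x) = c * \<psi> x})"
  have "closed Z"
    unfolding Z_def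
    by (intro closed_Int closed_INT ballI closed_Collect_eq continuous_intros continuous_on_product_coordinates)
  then have "compact (K0 \<inter> Z)" using K0 by (rule compact_Int_closed[rotated])
  moreover have "K0 \<inter> Z = {\<psi>. linear_functional_on S \<psi> \<and> (\<forall>x\<in>S. \<bar>\<psi> x\<bar> \<le> q x) \<and> (\<forall>x. x \<notin> S \<longrightarrow> \<psi> x = 0)}"
    unfolding K0_def Z_def linear_functional_on_def PiE_def Pi_def by (auto simp: abs_le_iff split: if_splits)
  ultimately show ?thesis by simp
qed

subsection \<open>Equicontinuous sets and bounded sets\<close>

lemma lcs_subspace: "lcs S P \<Longrightarrow> subspace S"
  and lcs_seminorm: "lcs S P \<Longrightarrow> p \<in> P \<Longrightarrow> seminorm_on S p"
  unfolding lcs_def by blast+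

lemma seminorm_on_nonneg: "seminorm_on S p \<Longrightarrow> x \<in> S \<Longrightarrow> 0 \<le> p x"
  and seminorm_on_add: "seminorm_on S p \<Longrightarrow> x \<in> S \<Longrightarrow> y \<in> S \<Longrightarrow> p (x + y) \<le> p x + p y"
  and seminorm_on_scale: "seminorm_on S p \<Longrightarrow> x \<in> S \<Longrightarrow> p (c *\<^sub>R x) = \<bar>c\<bar> * p x"
  unfolding seminorm_on_def by blast+

lemma seminorm_on_0: "seminorm_on S p \<Longrightarrow> 0 \<in> S \<Longrightarrow> p 0 = 0"
  using seminorm_on_scale[of S p 0 0] by simp

lemma seminorm_on_subset: "seminorm_on S p \<Longrightarrow> L \<subseteq> S \<Longrightarrow> seminorm_on L p"
  unfolding seminorm_on_def by blast

lemma lcs_subset: "lcs S P \<Longrightarrow> subspace L \<Longrightarrow> L \<subseteq> S \<Longrightarrow> lcs L P"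
  unfolding lcs_def using seminorm_on_subset by blast

lemma seminorm_on_weighted_sum:
  assumes "\<And>p. p \<in> F \<Longrightarrow> seminorm_on S p" "0 \<le> C"
  shows "seminorm_on S (\<lambda>x. C * (\<Sum>p\<in>F. p x))"
  unfolding seminorm_on_def
proof (intro conjI ballI allI)
  fix x assume x: "x \<in> S"
  then show "0 \<le> C * (\<Sum>p\<in>F. p x)"
    using assms by (intro mult_nonneg_nonneg sum_nonneg) (auto intro: seminorm_on_nonneg)
  fix c
  show "C * (\<Sum>p\<in>F. p (c *\<^sub>R x)) = \<bar>c\<bar> * (C * (\<Sum>p\<in>F. p x))"
    using assms(1) x by (simp add: seminorm_on_scale[OF _ x] sum_distrib_left mult.left_commute)
next
  fix x y assume x: "x \<in> S" and y: "y \<in> S"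
  have "(\<Sum>p\<in>F. p (x + y)) \<le> (\<Sum>p\<in>F. p x + p y)"
    using assms(1) x y by (intro sum_mono) (auto intro: seminorm_on_add)
  then show "C * (\<Sum>p\<in>F. p (x + y)) \<le> C * (\<Sum>p\<in>F. p x) + C * (\<Sum>p\<in>F. p y)"
    using mult_left_mono[OF _ assms(2)] by (simp add: sum.distrib flip: distrib_left)
qed

lemma lcs_sum_nonneg:
  assumes "lcs S P" "F \<subseteq> P" "x \<in> S"
  shows "0 \<le> (\<Sum>p\<in>F. p x)"
  using assms by (intro sum_nonneg) (auto intro: seminorm_on_nonneg lcs_seminorm)

text \<open>Sums of seminorms are nonnegative, so the constant may be replaced by its absolute
  value; a nonnegative one is needed when estimates are enlarged or multiplied.\<close>

lemma dominatedE:
  assumes "lcs S P" "dominated S P q"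
  obtains F C where "finite F" "F \<subseteq> P" "0 \<le> C" "\<And>x. x \<in> S \<Longrightarrow> q x \<le> C * (\<Sum>p\<in>F. p x)"
proof -
  obtain F C where FC: "finite F" "F \<subseteq> P" "\<And>x. x \<in> S \<Longrightarrow> q x \<le> C * (\<Sum>p\<in>F. p x)"
    using assms(2) unfolding dominated_def by blast
  have "q x \<le> \<bar>C\<bar> * (\<Sum>p\<in>F. p x)" if "x \<in> S" for x
    using FC(3)[OF that] mult_right_mono[OF abs_ge_self lcs_sum_nonneg[OF assms(1) FC(2) that], of C]
    by linarith
  then show ?thesis using that[of F "\<bar>C\<bar>"] FC by simp
qed

lemma dominated_sum:
  assumes lcs: "lcs S P" and "finite G" and "\<And>q. q \<in> G \<Longrightarrow> dominated S P (h q)" and C: "0 \<le> C"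
  shows "dominated S P (\<lambda>x. C * (\<Sum>q\<in>G. h q x))"
proof -
  have "\<exists>F D. finite F \<and> F \<subseteq> P \<and> 0 \<le> D \<and> (\<forall>x\<in>S. (\<Sum>q\<in>G. h q x) \<le> D * (\<Sum>p\<in>F. p x))"
    using assms(2,3)
  proof (induction G)
    case empty
    show ?case by (rule exI[of _ "{}"], rule exI[of _ 0]) simp
  next
    case (insert q G)
    then obtain F D where F: "finite F" "F \<subseteq> P" "0 \<le> D" "\<forall>x\<in>S. (\<Sum>q\<in>G. h q x) \<le> D * (\<Sum>p\<in>F. p x)"
      by auto
    obtain F' D' where F': "finite F'" "F' \<subseteq> P" "0 \<le> D'" "\<And>x. x \<in> S \<Longrightarrow> h q x \<le> D' * (\<Sum>p\<in>F'. p x)"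
      using dominatedE[OF lcs insert.prems[of q]] by auto
    have "(\<Sum>q\<in>insert q G. h q x) \<le> (D + D') * (\<Sum>p\<in>F \<union> F'. p x)" if x: "x \<in> S" for x
    proof -
      have nn: "0 \<le> p x" if "p \<in> P" for p using seminorm_on_nonneg[OF lcs_seminorm[OF lcs that] x] .
      have "D * (\<Sum>p\<in>F. p x) \<le> D * (\<Sum>p\<in>F \<union> F'. p x)" "D' * (\<Sum>p\<in>F'. p x) \<le> D' * (\<Sum>p\<in>F \<union> F'. p x)"
        using F F' nn by (auto intro!: mult_left_mono sum_mono2)
      then show ?thesis using F(4) F'(4)[OF x] x insert.hyps by (simp add: distrib_right) fastforce
    qed
    then show ?case using F F' by (intro exI[of _ "F \<union> F'"] exI[of _ "D + D'"]) auto
  qed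
  then obtain F D where F: "finite F" "F \<subseteq> P" "\<And>x. x \<in> S \<Longrightarrow> (\<Sum>q\<in>G. h q x) \<le> D * (\<Sum>p\<in>F. p x)"
    by blast
  have "C * (\<Sum>q\<in>G. h q x) \<le> (C * D) * (\<Sum>p\<in>F. p x)" if "x \<in> S" for x
    using mult_left_mono[OF F(3)[OF that] C] by (simp add: mult.assoc)
  then show ?thesis unfolding dominated_def using F(1,2) by blast
qed

lemma equicontinuousI:
  assumes "\<And>\<phi>. \<phi> \<in> K \<Longrightarrow> linear_functional_on S \<phi>" "\<And>\<phi> x. \<phi> \<in> K \<Longrightarrow> x \<notin> S \<Longrightarrow> \<phi> x = 0"
    and "dominated S P q" "\<And>\<phi> x. \<phi> \<in> K \<Longrightarrow> x \<in> S \<Longrightarrow> \<bar>\<phi> x\<bar> \<le> q x"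
  shows "equicontinuous S P K"
proof -
  obtain F C where FC: "finite F" "F \<subseteq> P" "\<And>x. x \<in> S \<Longrightarrow> q x \<le> C * (\<Sum>p\<in>F. p x)"
    using assms(3) unfolding dominated_def by blast
  have bd: "\<bar>\<phi> x\<bar> \<le> C * (\<Sum>p\<in>F. p x)" if "\<phi> \<in> K" "x \<in> S" for \<phi> x
    using assms(4)[OF that] FC(3)[OF that(2)] by linarith
  moreover have "\<phi> \<in> lcs_dual S P" if "\<phi> \<in> K" for \<phi>
  proof -
    have "dominated S P (\<lambda>x. \<bar>\<phi> x\<bar>)" unfolding dominated_def using FC(1,2) bd[OF that] by blast
    then show ?thesis
      using assms(1,2)[OF that] unfolding lcs_dual_def linear_functional_on_def by blast
  qed
  ultimately show ?thesis unfolding equicontinuous_def using FC(1,2) by blast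
qed

lemma eqcE:
  assumes "lcs S P" "K \<in> eqc S P"
  obtains F C where "finite F" "F \<subseteq> P" "0 \<le> C"
    "\<And>\<phi> x. \<phi> \<in> K \<Longrightarrow> x \<in> S \<Longrightarrow> \<bar>\<phi> x\<bar> \<le> C * (\<Sum>p\<in>F. p x)"
proof -
  obtain F C where FC: "finite F" "F \<subseteq> P" "\<And>\<phi> x. \<phi> \<in> K \<Longrightarrow> x \<in> S \<Longrightarrow> \<bar>\<phi> x\<bar> \<le> C * (\<Sum>p\<in>F. p x)"
    using assms(2) unfolding eqc_def equicontinuous_def by blast
  have "\<bar>\<phi> x\<bar> \<le> \<bar>C\<bar> * (\<Sum>p\<in>F. p x)" if "\<phi> \<in> K" "x \<in> S" for \<phi> x
    using FC(3)[OF that] mult_right_mono[OF abs_ge_self lcs_sum_nonneg[OF assms(1) FC(2) that(2)], of C]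
    by linarith
  then show ?thesis using that[of F "\<bar>C\<bar>"] FC by simp
qed

lemma eqc_linear: "K \<in> eqc S P \<Longrightarrow> \<phi> \<in> K \<Longrightarrow> linear_functional_on S \<phi>"
  unfolding eqc_def equicontinuous_def lcs_dual_def linear_functional_on_def by blast

text \<open>Supplies the uniform bound under which a sum of functionals can be split into its
  terms.\<close>

lemma eqc_bounded:
  assumes "lcs S P" "K \<in> eqc S P" "lcs_bounded S P B"
  obtains M where "\<And>\<phi> x. \<phi> \<in> K \<Longrightarrow> x \<in> B \<Longrightarrow> \<bar>\<phi> x\<bar> \<le> M"
proof -
  obtain F C where FC: "finite F" "F \<subseteq> P" "0 \<le> C" "\<And>\<phi> x. \<phi> \<in> K \<Longrightarrow> x \<in> S \<Longrightarrow> \<bar>\<phi> x\<bar> \<le> C * (\<Sum>p\<in>F. p x)"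
    using eqcE[OF assms(1,2)] by metis
  obtain m where m: "\<And>p x. p \<in> P \<Longrightarrow> x \<in> B \<Longrightarrow> p x \<le> m p"
    using assms(3) unfolding lcs_bounded_def by metis
  have "\<bar>\<phi> x\<bar> \<le> C * (\<Sum>p\<in>F. m p)" if "\<phi> \<in> K" "x \<in> B" for \<phi> x
  proof -
    have "x \<in> S" using assms(3) that unfolding lcs_bounded_def by blast
    then have "\<bar>\<phi> x\<bar> \<le> C * (\<Sum>p\<in>F. p x)" using FC(4) that by blast
    also have "\<dots> \<le> C * (\<Sum>p\<in>F. m p)"
      using FC(2) m that by (intro mult_left_mono[OF _ FC(3)] sum_mono) auto
    finally show ?thesis .
  qed
  then show ?thesis by (rule that)
qed

section \<open>Tameness in terms of sequences of vectors\<close>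

lemma tame_familyI:
  assumes "\<And>b. (\<And>n. b n \<in> B) \<Longrightarrow> \<not> independent_seq K (\<lambda>n \<phi>. \<phi> (b n))"
  shows "tame_family K ((\<lambda>b \<phi>. \<phi> b) ` B)"
  unfolding tame_family_def
proof
  assume "\<exists>f. range f \<subseteq> (\<lambda>b \<phi>. \<phi> b) ` B \<and> independent_seq K f"
  then obtain f where f: "range f \<subseteq> (\<lambda>b \<phi>. \<phi> b) ` B" "independent_seq K f" by blast
  have "\<exists>b. b \<in> B \<and> f n = (\<lambda>\<phi>. \<phi> b)" for n using f(1) by blast
  then obtain b where b: "\<And>n. b n \<in> B" "\<And>n. f n = (\<lambda>\<phi>. \<phi> (b n))" by metis
  have "f = (\<lambda>n \<phi>. \<phi> (b n))" using b(2) by (rule ext)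
  then show False using assms[OF b(1)] f(2) by simp
qed

lemma tame_lcsD:
  assumes "tame_lcs S P" "lcs_bounded S P B" "K \<in> eqc S P" "\<And>n. b n \<in> B"
  shows "\<not> independent_seq K (\<lambda>n \<phi>. \<phi> (b n))"
proof -
  have "tame_family K ((\<lambda>b \<phi>. \<phi> b) ` B)" using assms(1-3) unfolding tame_lcs_def by blast
  moreover have "range (\<lambda>n \<phi>. \<phi> (b n)) \<subseteq> (\<lambda>b \<phi>. \<phi> b) ` B" using assms(4) by blast
  ultimately show ?thesis unfolding tame_family_def by blast
qed

lemma tame_lcsI:
  assumes "\<And>B K b. lcs_bounded S P B \<Longrightarrow> K \<in> eqc S P \<Longrightarrow> (\<And>n. b n \<in> B) \<Longrightarrow>
      \<not> independent_seq K (\<lambda>n \<phi>. \<phi> (b n))"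
  shows "tame_lcs S P"
  unfolding tame_lcs_def by (intro allI impI tame_familyI assms)

text \<open>The adjoint of \<open>T\<close>, truncated because \<open>lcs_dual\<close> demands
  functions that vanish off the carrier.\<close>

definition pullback :: "'a set \<Rightarrow> ('a \<Rightarrow> 'b) \<Rightarrow> ('b \<Rightarrow> real) \<Rightarrow> 'a \<Rightarrow> real" where
  "pullback S T \<phi> = (\<lambda>x. if x \<in> S then \<phi> (T x) else 0)"

text \<open>Composing a bound for \<open>K\<close> with a continuous \<open>T\<close> gives a
  dominated bound. The adjoint is continuous for pointwise convergence, since each of its
  coordinates is an evaluation or constantly 0; so it preserves compactness.\<close>

lemma eqc_pullback:
  assumes 1: "lcs S1 P1" and 2: "lcs S2 P2" and T: "cont_linear S1 P1 S2 P2 T" and K: "K \<in> eqc S2 P2"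
  shows "pullback S1 T ` K \<in> eqc S1 P1"
proof -
  have S1: "subspace S1" using 1 by (rule lcs_subspace)
  have TS: "T x \<in> S2" if "x \<in> S1" for x using T that unfolding cont_linear_def by blast
  obtain F C where FC: "finite F" "F \<subseteq> P2" "0 \<le> C" "\<And>\<phi> x. \<phi> \<in> K \<Longrightarrow> x \<in> S2 \<Longrightarrow> \<bar>\<phi> x\<bar> \<le> C * (\<Sum>p\<in>F. p x)"
    using eqcE[OF 2 K] by metis
  have "equicontinuous S1 P1 (pullback S1 T ` K)"
  proof (rule equicontinuousI)
    show "dominated S1 P1 (\<lambda>x. C * (\<Sum>q\<in>F. q (T x)))"
      using 1 FC(1) _ FC(3)
      by (rule dominated_sum) (use T FC(2) in \<open>auto simp: cont_linear_def\<close>)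
    fix \<psi> assume "\<psi> \<in> pullback S1 T ` K"
    then obtain \<phi> where \<phi>: "\<phi> \<in> K" "\<psi> = pullback S1 T \<phi>" by blast
    have lin: "linear_functional_on S2 \<phi>" using eqc_linear[OF K \<phi>(1)] .
    show "linear_functional_on S1 \<psi>"
      unfolding linear_functional_on_def \<phi>(2) pullback_def
      using T lin TS S1 unfolding cont_linear_def linear_functional_on_def
      by (simp add: subspace_add subspace_scale)
    fix x
    show "x \<notin> S1 \<Longrightarrow> \<psi> x = 0" by (simp add: \<phi>(2) pullback_def)
    show "x \<in> S1 \<Longrightarrow> \<bar>\<psi> x\<bar> \<le> C * (\<Sum>q\<in>F. q (T x))"
      using FC(4)[OF \<phi>(1) TS] by (simp add: \<phi>(2) pullback_def)
  qed
  moreover have "compact (pullback S1 T ` K)"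
  proof (rule compact_continuous_image)
    show "continuous_on K (pullback S1 T)"
    proof (rule continuous_on_coordinatewise_then_product)
      fix x
      show "continuous_on K (\<lambda>\<phi>. pullback S1 T \<phi> x)"
        unfolding pullback_def
        by (cases "x \<in> S1") (auto intro: continuous_on_subset[OF continuous_on_product_coordinates])
    qed
    show "compact K" using K unfolding eqc_def by blast
  qed
  ultimately show ?thesis unfolding eqc_def by blast
qed

subsection \<open>Permanence properties\<close>

theorem tame_lcs_subspace:
  assumes lcs: "lcs S P" and tame: "tame_lcs S P" and L: "subspace L" "L \<subseteq> S"
  shows "tame_lcs L P"
proof (rule tame_lcsI)
  fix B K and b :: "nat \<Rightarrow> 'a"
  assume B: "lcs_bounded L P B" and K: "K \<in> eqc L P" and b: "\<And>n. b n \<in> B"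
  have S: "subspace S" using lcs by (rule lcs_subspace)
  have L': "lcs L P" using lcs_subset[OF lcs L] .
  obtain F C where FC: "finite F" "F \<subseteq> P" "0 \<le> C" "\<And>\<phi> x. \<phi> \<in> K \<Longrightarrow> x \<in> L \<Longrightarrow> \<bar>\<phi> x\<bar> \<le> C * (\<Sum>p\<in>F. p x)"
    using eqcE[OF L' K] by metis
  define q where "q = (\<lambda>x. C * (\<Sum>p\<in>F. p x))"
  have q: "seminorm_on S q"
    unfolding q_def using FC(2,3) lcs by (intro seminorm_on_weighted_sum) (auto intro: lcs_seminorm)
  define K' where "K' = {\<psi>. linear_functional_on S \<psi> \<and> (\<forall>x\<in>S. \<bar>\<psi> x\<bar> \<le> q x) \<and> (\<forall>x. x \<notin> S \<longrightarrow> \<psi> x = 0)}"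
  have "equicontinuous S P K'"
  proof (rule equicontinuousI)
    show "dominated S P q" unfolding dominated_def q_def using FC(1,2) by blast
  qed (auto simp: K'_def)
  moreover have "compact K'" unfolding K'_def by (rule Banach_Alaoglu_seminorm_on)
  ultimately have K': "K' \<in> eqc S P" unfolding eqc_def by blast
  have "\<exists>\<psi>. \<psi> \<in> K' \<and> (\<forall>x\<in>L. \<psi> x = \<phi> x)" if \<phi>: "\<phi> \<in> K" for \<phi>
  proof -
    have le: "\<bar>\<phi> x\<bar> \<le> q x" if "x \<in> L" for x using FC(4)[OF \<phi> that] by (simp add: q_def)
    obtain \<psi> where "linear_functional_on S \<psi>" "\<And>x. x \<in> S \<Longrightarrow> \<bar>\<psi> x\<bar> \<le> q x"
      "\<And>x. x \<in> L \<Longrightarrow> \<psi> x = \<phi> x" "\<And>x. x \<notin> S \<Longrightarrow> \<psi> x = 0"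
      using Hahn_Banach_seminorm_on[OF S q L eqc_linear[OF K \<phi>] le] by blast
    then show ?thesis unfolding K'_def by blast
  qed
  \<comment> \<open>A mere choice of extensions: compactness belongs to \<open>K'\<close>, so
    \<open>E\<close> only has to land there and to agree on \<open>L\<close>.\<close>
  then obtain E where E: "\<And>\<phi>. \<phi> \<in> K \<Longrightarrow> E \<phi> \<in> K'" "\<And>\<phi> x. \<phi> \<in> K \<Longrightarrow> x \<in> L \<Longrightarrow> E \<phi> x = \<phi> x" by metis
  have BL: "B \<subseteq> L" using B unfolding lcs_bounded_def by blast
  then have "lcs_bounded S P B" using B L unfolding lcs_bounded_def by blast
  then have "\<not> independent_seq K' (\<lambda>n \<phi>. \<phi> (b n))" using tame_lcsD[where b = b, OF tame _ K' b] by blast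
  moreover have "independent_seq K' (\<lambda>n \<phi>. \<phi> (b n))" if "independent_seq K (\<lambda>n \<phi>. \<phi> (b n))"
    using that by (rule independent_seq_map[where h = E]) (use E(1) E(2)[OF _ subsetD[OF BL b]] in auto)
  ultimately show "\<not> independent_seq K (\<lambda>n \<phi>. \<phi> (b n))" by blast
qed

text \<open>Vectors are lifted and functionals pulled back, so that \<open>\<phi> (b n)\<close> is
  the value of the pullback at the lift \<open>c n\<close>. Bound covering places all lifts in one
  bounded set.\<close>

theorem tame_lcs_bound_covering:
  assumes 1: "lcs S1 P1" and 2: "lcs S2 P2" and tame: "tame_lcs S1 P1" and f: "bound_covering S1 P1 S2 P2 f"
  shows "tame_lcs S2 P2"
proof (rule tame_lcsI)
  fix B K and b :: "nat \<Rightarrow> 'b"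
  assume B: "lcs_bounded S2 P2 B" and K: "K \<in> eqc S2 P2" and b: "\<And>n. b n \<in> B"
  have fc: "cont_linear S1 P1 S2 P2 f" using f unfolding bound_covering_def by blast
  obtain B1 where B1: "lcs_bounded S1 P1 B1" "f ` B1 = B"
    using f B unfolding bound_covering_def by blast
  have "\<exists>c. c \<in> B1 \<and> f c = b n" for n using b[of n] B1(2) by (metis imageE)
  then obtain c where c: "\<And>n. c n \<in> B1" "\<And>n. f (c n) = b n" by metis
  have "c n \<in> S1" for n using c(1) B1(1) unfolding lcs_bounded_def by blast
  then have "independent_seq (pullback S1 f ` K) (\<lambda>n \<phi>. \<phi> (c n))"
    if "independent_seq K (\<lambda>n \<phi>. \<phi> (b n))"
    using that by (rule_tac independent_seq_map[where h = "pullback S1 f"]) (auto simp: pullback_def c(2))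
  then show "\<not> independent_seq K (\<lambda>n \<phi>. \<phi> (b n))"
    using tame_lcsD[where b = c, OF tame B1(1) eqc_pullback[OF 1 2 fc K] c(1)] by blast
qed

text \<open>Common core of products and direct sums. If the functionals in \<open>K\<close> split on
  \<open>B\<close> into finitely many terms that factor through tame spaces, an independent sequence
  would pass to one term along a subsequence.\<close>

lemma tame_family_finite_decomposition:
  assumes E: "lcs E Q" and K: "K \<in> eqc E Q" and J: "finite J"
    and S: "\<And>i. i \<in> J \<Longrightarrow> lcs (S i) (P i)" and tame: "\<And>i. i \<in> J \<Longrightarrow> tame_lcs (S i) (P i)"
    and T: "\<And>i. i \<in> J \<Longrightarrow> cont_linear (S i) (P i) E Q (T i)"
    and B: "\<And>i. i \<in> J \<Longrightarrow> lcs_bounded (S i) (P i) (\<pi> i ` B)"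
    and decomp: "\<And>\<phi> x. \<phi> \<in> K \<Longrightarrow> x \<in> B \<Longrightarrow> \<phi> x = (\<Sum>i\<in>J. \<phi> (T i (\<pi> i x)))"
  shows "tame_family K ((\<lambda>b \<phi>. \<phi> b) ` B)"
proof (rule tame_familyI, rule notI)
  fix b :: "nat \<Rightarrow> 'a"
  assume b: "\<And>n. b n \<in> B" and ind: "independent_seq K (\<lambda>n \<phi>. \<phi> (b n))"
  have Ki: "pullback (S i) (T i) ` K \<in> eqc (S i) (P i)" if "i \<in> J" for i
    using eqc_pullback[OF S E T K] that by blast
  have pb: "pullback (S i) (T i) \<phi> (\<pi> i (b n)) = \<phi> (T i (\<pi> i (b n)))" if "i \<in> J" for i n \<phi>
  proof -
    have "\<pi> i (b n) \<in> S i" using B[OF that] b[of n] unfolding lcs_bounded_def by blast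
    then show ?thesis by (simp add: pullback_def)
  qed
  have "\<exists>i\<in>J. \<exists>r. independent_seq K ((\<lambda>n \<phi>. \<phi> (T i (\<pi> i (b n)))) \<circ> r)"
  proof (rule independent_seq_sum[OF J])
    show "independent_seq K (\<lambda>n \<phi>. \<Sum>i\<in>J. \<phi> (T i (\<pi> i (b n))))"
      using ind by (rule independent_seq_map[where h = "\<lambda>\<phi>. \<phi>"]) (use decomp b in auto)
    fix i assume i: "i \<in> J"
    obtain M where M: "\<And>\<phi> x. \<phi> \<in> pullback (S i) (T i) ` K \<Longrightarrow> x \<in> \<pi> i ` B \<Longrightarrow> \<bar>\<phi> x\<bar> \<le> M"
      using eqc_bounded[OF S[OF i] Ki[OF i] B[OF i]] by blast
    have "\<bar>\<phi> (T i (\<pi> i (b n)))\<bar> \<le> M" if "\<phi> \<in> K" for n \<phi>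
      using M[of "pullback (S i) (T i) \<phi>" "\<pi> i (b n)"] that b by (simp add: pb[OF i])
    then show "\<exists>M. \<forall>n. \<forall>\<phi>\<in>K. \<bar>\<phi> (T i (\<pi> i (b n)))\<bar> \<le> M" by blast
  qed
  then obtain i r where i: "i \<in> J" and r: "independent_seq K (\<lambda>n \<phi>. \<phi> (T i (\<pi> i (b (r n)))))"
    by (auto simp: comp_def)
  from r have "independent_seq (pullback (S i) (T i) ` K) (\<lambda>n \<phi>. \<phi> (\<pi> i (b (r n))))"
    by (rule independent_seq_map[where h = "pullback (S i) (T i)"]) (auto simp: pb[OF i])
  moreover have "\<pi> i (b (r n)) \<in> \<pi> i ` B" for n using b by blast
  ultimately show False using tame_lcsD[OF tame[OF i] B[OF i] Ki[OF i], of "\<lambda>n. \<pi> i (b (r n))"] by blast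
qed

section \<open>Coordinates, products and inverse limits\<close>

lemma linear_functional_on_0: "linear_functional_on S \<phi> \<Longrightarrow> 0 \<in> S \<Longrightarrow> \<phi> 0 = 0"
  unfolding linear_functional_on_def by (metis mult_zero_left scaleR_zero_left)

lemma linear_functional_on_sum:
  assumes "subspace S" "linear_functional_on S \<phi>" "finite J" "\<And>i. i \<in> J \<Longrightarrow> v i \<in> S"
  shows "\<phi> (\<Sum>i\<in>J. v i) = (\<Sum>i\<in>J. \<phi> (v i))"
  using assms(3,4)
proof (induction J)
  case empty
  then show ?case using linear_functional_on_0[OF assms(2)] assms(1) by (simp add: subspace_0)
next
  case (insert j J)
  have "(\<Sum>i\<in>J. v i) \<in> S" using insert assms(1) by (intro subspace_sum) auto
  then have "\<phi> (v j + (\<Sum>i\<in>J. v i)) = \<phi> (v j) + \<phi> (\<Sum>i\<in>J. v i)"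
    using assms(2) insert.prems[of j] unfolding linear_functional_on_def by blast
  then show ?case using insert by simp
qed

lemma sum_dsum_inj:
  "finite J \<Longrightarrow> (\<Sum>i\<in>J. dsum_inj i (x i)) = (\<lambda>j. if j \<in> J then x j else 0)"
  by (induction J rule: finite_induct) (auto simp: dsum_inj_def fun_eq_iff)

lemma dsum_inj_add: "dsum_inj i (v + w) = dsum_inj i v + dsum_inj i w"
  and dsum_inj_scaleR: "dsum_inj i (c *\<^sub>R v) = c *\<^sub>R dsum_inj i v"
  by (auto simp: dsum_inj_def fun_eq_iff scaleR_fun_def)

lemma dsum_inj_apply: "dsum_inj i v j = (if j = i then v else 0)"
  by (simp add: dsum_inj_def)

lemma scaleR_fun_apply: "(c *\<^sub>R x) i = c *\<^sub>R x i"
  by (simp add: scaleR_fun_def)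

lemma subspace_prod_carrier:
  assumes "\<And>i. i \<in> I \<Longrightarrow> subspace (S i)"
  shows "subspace (prod_carrier I S)"
  unfolding subspace_def prod_carrier_def
  using assms by (auto simp: scaleR_fun_def subspace_0 subspace_add subspace_scale)

lemma seminorm_on_coordinate:
  assumes "seminorm_on (S i) p" "i \<in> I"
  shows "seminorm_on (prod_carrier I S) (\<lambda>x. p (x i))"
  using assms unfolding seminorm_on_def prod_carrier_def by (simp add: scaleR_fun_def)

lemma lcs_prod:
  assumes "\<And>i. i \<in> I \<Longrightarrow> lcs (S i) (P i)"
  shows "lcs (prod_carrier I S) (prod_seminorms I P)"
  unfolding lcs_def
proof
  show "subspace (prod_carrier I S)" using assms by (intro subspace_prod_carrier lcs_subspace)
  show "\<forall>p\<in>prod_seminorms I P. seminorm_on (prod_carrier I S) p"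
    unfolding prod_seminorms_def using assms by (auto intro!: seminorm_on_coordinate intro: lcs_seminorm)
qed

lemma dsum_inj_in_dsum_carrier:
  assumes "\<And>i. i \<in> I \<Longrightarrow> subspace (S i)" "i \<in> I" "v \<in> S i"
  shows "dsum_inj i v \<in> dsum_carrier I S"
proof -
  have "{j. dsum_inj i v j \<noteq> 0} \<subseteq> {i}" by (auto simp: dsum_inj_def)
  then have "finite {j. dsum_inj i v j \<noteq> 0}" by (rule finite_subset) simp
  then show ?thesis
    using assms unfolding dsum_carrier_def prod_carrier_def by (auto simp: dsum_inj_apply subspace_0)
qed

text \<open>The composition is \<open>p\<close> itself if \<open>i = j\<close>, and the constant
  \<open>p 0 = 0\<close> otherwise.\<close>

lemma dominated_coordinate_inj:
  assumes "lcs (S i) (P i)" "p \<in> P i" "lcs (S j) (P j)"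
  shows "dominated (S j) (P j) (\<lambda>v. p (dsum_inj j v i))"
proof (cases "i = j")
  case True
  then show ?thesis
    unfolding dominated_def using assms(2)
    by (intro exI[of _ "{p}"] exI[of _ 1]) (auto simp: dsum_inj_apply)
next
  case False
  have "p 0 = 0" using seminorm_on_0[OF lcs_seminorm[OF assms(1,2)] subspace_0[OF lcs_subspace[OF assms(1)]]] .
  then show ?thesis
    unfolding dominated_def using False
    by (intro exI[of _ "{}"] exI[of _ 0]) (auto simp: dsum_inj_apply)
qed

theorem tame_lcs_prod:
  assumes S: "\<And>i. i \<in> I \<Longrightarrow> lcs (S i) (P i)" and tame: "\<And>i. i \<in> I \<Longrightarrow> tame_lcs (S i) (P i)"
  shows "tame_lcs (prod_carrier I S) (prod_seminorms I P)"
  unfolding tame_lcs_def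
proof (intro allI impI)
  fix B K
  assume B: "lcs_bounded (prod_carrier I S) (prod_seminorms I P) B"
    and K: "K \<in> eqc (prod_carrier I S) (prod_seminorms I P)"
  let ?E = "prod_carrier I S" and ?Q = "prod_seminorms I P"
  have lcsE: "lcs ?E ?Q" using S by (rule lcs_prod)
  have E: "subspace ?E" using lcsE by (rule lcs_subspace)
  have injE: "dsum_inj i v \<in> ?E" if "i \<in> I" "v \<in> S i" for i v
    using dsum_inj_in_dsum_carrier[of I S, OF _ that] S lcs_subspace unfolding dsum_carrier_def by blast
  obtain F C where FC: "finite F" "F \<subseteq> ?Q" "\<And>\<phi> x. \<phi> \<in> K \<Longrightarrow> x \<in> ?E \<Longrightarrow> \<bar>\<phi> x\<bar> \<le> C * (\<Sum>p\<in>F. p x)"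
    using eqcE[OF lcsE K] by metis
  have "\<exists>i p. i \<in> I \<and> p \<in> P i \<and> q = (\<lambda>x. p (x i))" if "q \<in> F" for q
    using FC(2) that unfolding prod_seminorms_def by blast
  then obtain i p where ip: "\<And>q. q \<in> F \<Longrightarrow> i q \<in> I" "\<And>q. q \<in> F \<Longrightarrow> p q \<in> P (i q)"
    "\<And>q. q \<in> F \<Longrightarrow> q = (\<lambda>x. p q (x (i q)))" by metis
  \<comment> \<open>The coordinates seen by the seminorms that bound \<open>K\<close>.\<close>
  define J where "J = i ` F"
  have J: "finite J" "J \<subseteq> I" using FC(1) ip(1) by (auto simp: J_def)
  have xS: "x j \<in> S j" if "x \<in> ?E" "j \<in> I" for x j using that unfolding prod_carrier_def by blast
  show "tame_family K ((\<lambda>b \<phi>. \<phi> b) ` B)"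
  proof (rule tame_family_finite_decomposition[OF lcsE K J(1), where S = S and P = P and T = dsum_inj
        and \<pi> = "\<lambda>i x. x i"])
    fix j assume "j \<in> J"
    then have j: "j \<in> I" using J(2) by blast
    show "lcs (S j) (P j)" "tame_lcs (S j) (P j)" using S tame j by blast+
    show "cont_linear (S j) (P j) ?E ?Q (dsum_inj j)"
      unfolding cont_linear_def
    proof (intro conjI ballI allI)
      fix q assume "q \<in> ?Q"
      then obtain k p where "k \<in> I" "p \<in> P k" "q = (\<lambda>x. p (x k))" unfolding prod_seminorms_def by blast
      then show "dominated (S j) (P j) (\<lambda>v. q (dsum_inj j v))"
        using dominated_coordinate_inj[of S k P p j] S j by simp
    qed (use injE[OF j] in \<open>auto simp: dsum_inj_add dsum_inj_scaleR\<close>)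
    show "lcs_bounded (S j) (P j) ((\<lambda>x. x j) ` B)"
      unfolding lcs_bounded_def
    proof
      show "(\<lambda>x. x j) ` B \<subseteq> S j" using B xS j unfolding lcs_bounded_def by blast
      show "\<forall>p\<in>P j. \<exists>M. \<forall>x\<in>(\<lambda>x. x j) ` B. p x \<le> M"
      proof
        fix p assume "p \<in> P j"
        then have "(\<lambda>x. p (x j)) \<in> ?Q" using j unfolding prod_seminorms_def by blast
        then show "\<exists>M. \<forall>x\<in>(\<lambda>x. x j) ` B. p x \<le> M" using B unfolding lcs_bounded_def by fast
      qed
    qed
  next
    fix \<phi> x assume \<phi>: "\<phi> \<in> K" and "x \<in> B"
    then have x: "x \<in> ?E" using B unfolding lcs_bounded_def by blast
    have lin: "linear_functional_on ?E \<phi>" using eqc_linear[OF K \<phi>] .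
    define s where "s = (\<Sum>j\<in>J. dsum_inj j (x j))"
    have s_eq: "s = (\<lambda>j. if j \<in> J then x j else 0)"
      unfolding s_def by (rule sum_dsum_inj[OF J(1)])
    have sE: "dsum_inj j (x j) \<in> ?E" if "j \<in> J" for j using injE[of j] xS[OF x] J(2) that by blast
    then have s: "s \<in> ?E" unfolding s_def using E by (intro subspace_sum) auto
    have d: "x - s \<in> ?E" using E x s by (rule subspace_diff)
    \<comment> \<open>\<open>s\<close> agrees with \<open>x\<close> on \<open>J\<close>, so the
      difference is invisible to all of \<open>F\<close> and every functional in \<open>K\<close>
      annihilates it.\<close>
    have "q (x - s) = 0" if q: "q \<in> F" for q
    proof -
      have "(x - s) (i q) = 0" using q by (simp add: s_eq J_def)
      moreover have "p q 0 = 0"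
        using seminorm_on_0[OF lcs_seminorm[OF S[OF ip(1)[OF q]] ip(2)[OF q]]]
          subspace_0[OF lcs_subspace[OF S[OF ip(1)[OF q]]]] .
      ultimately show ?thesis using ip(3)[OF q] by metis
    qed
    then have "(\<Sum>q\<in>F. q (x - s)) = 0" by (intro sum.neutral) blast
    then have "\<bar>\<phi> (x - s)\<bar> \<le> C * 0" using FC(3)[OF \<phi> d] by metis
    moreover have "\<phi> ((x - s) + s) = \<phi> (x - s) + \<phi> s"
      using lin d s unfolding linear_functional_on_def by blast
    ultimately have "\<phi> x = \<phi> s" by simp
    then show "\<phi> x = (\<Sum>j\<in>J. \<phi> (dsum_inj j (x j)))"
      unfolding s_def using linear_functional_on_sum[OF E lin J(1) sE] by simp
  qed
qed

theorem tame_lcs_invlim: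
  assumes sys: "inverse_system I le S P f" and tame: "\<And>i. i \<in> I \<Longrightarrow> tame_lcs (S i) (P i)"
  shows "tame_lcs (invlim_carrier I le S f) (prod_seminorms I P)"
proof (rule tame_lcs_subspace)
  have S: "lcs (S i) (P i)" if "i \<in> I" for i
    using sys that unfolding inverse_system_def by blast
  show lcsE: "lcs (prod_carrier I S) (prod_seminorms I P)" using S by (rule lcs_prod)
  show "tame_lcs (prod_carrier I S) (prod_seminorms I P)" using S tame by (rule tame_lcs_prod)
  show "invlim_carrier I le S f \<subseteq> prod_carrier I S" unfolding invlim_carrier_def by blast
  have f: "cont_linear (S j) (P j) (S i) (P i) (f i j)" if "i \<in> I" "j \<in> I" "le i j" for i j
    using sys that unfolding inverse_system_def by blast
  have fadd: "f i j (v + w) = f i j v + f i j w" if "i \<in> I" "j \<in> I" "le i j" "v \<in> S j" "w \<in> S j" for i j v w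
    using f[OF that(1-3)] that(4,5) unfolding cont_linear_def by blast
  have fscale: "f i j (c *\<^sub>R v) = c *\<^sub>R f i j v" if "i \<in> I" "j \<in> I" "le i j" "v \<in> S j" for i j v c
    using f[OF that(1-3)] that(4) unfolding cont_linear_def by blast
  have f0: "f i j 0 = 0" if "i \<in> I" "j \<in> I" "le i j" for i j
    using fscale[OF that subspace_0[OF lcs_subspace[OF S[OF that(2)]]], of 0] by simp
  have E: "subspace (prod_carrier I S)" using lcsE by (rule lcs_subspace)
  have xS: "x j \<in> S j" if "x \<in> prod_carrier I S" "j \<in> I" for x j using that unfolding prod_carrier_def by blast
  \<comment> \<open>Compatibility is a system of linear equations, since the connecting maps are
    linear on the carriers.\<close>
  show "subspace (invlim_carrier I le S f)"
    unfolding invlim_carrier_def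
    by (rule subspaceI)
      (use E in \<open>auto simp: subspace_0 subspace_add subspace_scale f0 fadd fscale xS scaleR_fun_apply\<close>)
qed

section \<open>Locally convex direct sums\<close>

lemma seminorm_on_dsum_coordinate:
  assumes "\<And>i. i \<in> I \<Longrightarrow> lcs (S i) (P i)" "i \<in> I" "p \<in> P i"
  shows "(\<lambda>x. p (x i)) \<in> dsum_seminorms I S P"
  unfolding dsum_seminorms_def
proof (intro CollectI conjI ballI)
  show "seminorm_on (dsum_carrier I S) (\<lambda>x. p (x i))"
    using seminorm_on_coordinate[where i = i and S = S, OF lcs_seminorm[OF assms(1)[OF assms(2)] assms(3)] assms(2)]
    by (rule seminorm_on_subset) (auto simp: dsum_carrier_def)
qed (use dominated_coordinate_inj[of S i P p] assms in blast)

lemma subspace_dsum_carrier: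
  assumes "\<And>i. i \<in> I \<Longrightarrow> subspace (S i)"
  shows "subspace (dsum_carrier I S)"
proof -
  have E: "subspace (prod_carrier I S)" using assms by (rule subspace_prod_carrier)
  have "finite {i. (x + y) i \<noteq> 0}" if "finite {i. x i \<noteq> 0}" "finite {i. y i \<noteq> 0}" for x y :: "'a \<Rightarrow> 'b"
    by (rule finite_subset[OF _ finite_UnI[OF that]]) auto
  moreover have "finite {i. (c *\<^sub>R x) i \<noteq> 0}" if "finite {i. x i \<noteq> 0}" for c and x :: "'a \<Rightarrow> 'b"
    by (rule finite_subset[OF _ that]) (auto simp: scaleR_fun_def)
  ultimately show ?thesis
    using E unfolding subspace_def dsum_carrier_def by auto
qed

lemma lcs_dsum:
  assumes "\<And>i. i \<in> I \<Longrightarrow> lcs (S i) (P i)"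
  shows "lcs (dsum_carrier I S) (dsum_seminorms I S P)"
  unfolding lcs_def dsum_seminorms_def
  using subspace_dsum_carrier[of I S] assms lcs_subspace by blast

text \<open>Otherwise a seminorm that weights a sequence of coordinates increasingly heavily is unbounded on \<open>B\<close>.\<close>

lemma bounded_dsum_finite_support:
  assumes S: "\<And>i. i \<in> I \<Longrightarrow> lcs (S i) (P i)"
    and B: "lcs_bounded (dsum_carrier I S) (dsum_seminorms I S P) B"
  shows "finite {i\<in>I. \<exists>x\<in>B. \<exists>p\<in>P i. p (x i) \<noteq> 0}"
proof (rule ccontr)
  assume "infinite {i\<in>I. \<exists>x\<in>B. \<exists>p\<in>P i. p (x i) \<noteq> 0}"
  then obtain e :: "nat \<Rightarrow> _" where e: "inj e" "range e \<subseteq> {i\<in>I. \<exists>x\<in>B. \<exists>p\<in>P i. p (x i) \<noteq> 0}"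
    using infinite_countable_subset by blast
  let ?E = "dsum_carrier I S"
  have eI: "e n \<in> I" for n using e(2) by blast
  have "\<exists>x p. x \<in> B \<and> p \<in> P (e n) \<and> p (x (e n)) \<noteq> 0" for n using e(2) by blast
  then obtain x p where xp: "\<And>n. x n \<in> B" "\<And>n. p n \<in> P (e n)" "\<And>n. p n (x n (e n)) \<noteq> 0" by metis
  have p: "seminorm_on (S (e n)) (p n)" for n using lcs_seminorm[OF S[OF eI] xp(2)] .
  have p0: "p n 0 = 0" for n using seminorm_on_0[OF p subspace_0[OF lcs_subspace[OF S[OF eI]]]] .
  have ES: "y (e n) \<in> S (e n)" if "y \<in> ?E" for y n
    using that eI unfolding dsum_carrier_def prod_carrier_def by blast
  have E: "subspace ?E" using S by (intro subspace_dsum_carrier lcs_subspace)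
  have xE: "x n \<in> ?E" for n using xp(1) B unfolding lcs_bounded_def by blast
  have pos: "0 < p n (x n (e n))" for n
    using seminorm_on_nonneg[OF p ES[OF xE]] xp(3)[of n] by (simp add: less_le)
  \<comment> \<open>The weight gives the \<open>n\<close>-th term the value \<open>n\<close> at the
    witness \<open>x n\<close>, which makes the seminorm unbounded on \<open>B\<close>.\<close>
  define c where "c = (\<lambda>n. real n / p n (x n (e n)))"
  have c: "0 \<le> c n" for n using pos[of n] by (simp add: c_def)
  \<comment> \<open>Elements have finite support and \<open>e\<close> is injective, so the sum is
    finite. Injectivity also leaves at most one term on a single summand, which gives continuity of
    each restriction.\<close>
  define q where "q = (\<lambda>y. \<Sum>n | y (e n) \<noteq> 0. c n * p n (y (e n)))"
  have fin: "finite {n. y (e n) \<noteq> 0}" if "y \<in> ?E" for y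
  proof -
    have "finite (e -` {i. y i \<noteq> 0})"
      using that e(1) unfolding dsum_carrier_def by (intro finite_vimageI) auto
    then show ?thesis by (simp add: vimage_def)
  qed
  \<comment> \<open>Any finite index set containing the support gives the same value, so two
    elements can be compared over a common set.\<close>
  have qN: "q y = (\<Sum>n\<in>N. c n * p n (y (e n)))" if "finite N" "{n. y (e n) \<noteq> 0} \<subseteq> N" for y N
    unfolding q_def using that by (intro sum.mono_neutral_left) (auto simp: p0)
  have "seminorm_on ?E q"
    unfolding seminorm_on_def
  proof (intro conjI ballI allI)
    fix y assume y: "y \<in> ?E"
    show "0 \<le> q y" unfolding q_def
      using c seminorm_on_nonneg[OF p ES[OF y]] by (intro sum_nonneg mult_nonneg_nonneg)
    fix a :: real
    have "q (a *\<^sub>R y) = (\<Sum>n | y (e n) \<noteq> 0. c n * p n ((a *\<^sub>R y) (e n)))"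
      using fin[OF y] by (intro qN) (auto simp: scaleR_fun_def)
    then show "q (a *\<^sub>R y) = \<bar>a\<bar> * q y"
      by (simp add: q_def scaleR_fun_def seminorm_on_scale[OF p ES[OF y]] sum_distrib_left mult.left_commute)
  next
    fix y z assume y: "y \<in> ?E" and z: "z \<in> ?E"
    define N where "N = {n. y (e n) \<noteq> 0} \<union> {n. z (e n) \<noteq> 0}"
    have N: "finite N" unfolding N_def using fin[OF y] fin[OF z] by blast
    have "q (y + z) = (\<Sum>n\<in>N. c n * p n ((y + z) (e n)))" by (rule qN[OF N]) (auto simp: N_def)
    also have "\<dots> \<le> (\<Sum>n\<in>N. c n * p n (y (e n)) + c n * p n (z (e n)))"
    proof (rule sum_mono)
      fix n
      show "c n * p n ((y + z) (e n)) \<le> c n * p n (y (e n)) + c n * p n (z (e n))"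
        using mult_left_mono[OF seminorm_on_add[OF p ES[OF y] ES[OF z]] c] by (simp add: distrib_left)
    qed
    also have "\<dots> = q y + q z"
      using qN[OF N, of y] qN[OF N, of z] by (simp add: sum.distrib N_def)
    finally show "q (y + z) \<le> q y + q z" .
  qed
  moreover have "dominated (S i) (P i) (\<lambda>v. q (dsum_inj i v))" if "i \<in> I" for i
  proof (cases "\<exists>n. i = e n")
    case True
    then obtain n where n: "i = e n" by blast
    have "q (dsum_inj i v) = c n * p n v" for v
    proof -
      have "{m. dsum_inj i v (e m) \<noteq> 0} \<subseteq> {n}" using inj_eq[OF e(1)] by (auto simp: n dsum_inj_apply)
      then have "q (dsum_inj i v) = (\<Sum>m\<in>{n}. c m * p m (dsum_inj i v (e m)))" by (intro qN) auto
      then show ?thesis by (simp add: n dsum_inj_apply)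
    qed
    then show ?thesis
      unfolding dominated_def using xp(2)[of n] n by (intro exI[of _ "{p n}"] exI[of _ "c n"]) simp
  next
    case False
    then have "q (dsum_inj i v) = 0" for v
      unfolding q_def by (intro sum.neutral) (auto simp: dsum_inj_apply)
    then show ?thesis unfolding dominated_def by (intro exI[of _ "{}"] exI[of _ 0]) simp
  qed
  ultimately have "q \<in> dsum_seminorms I S P" unfolding dsum_seminorms_def by blast
  then obtain M where M: "\<And>y. y \<in> B \<Longrightarrow> q y \<le> M" using B unfolding lcs_bounded_def by blast
  obtain n :: nat where n: "M < n" using reals_Archimedean2 by blast
  have "x n (e n) \<noteq> 0" using p0[of n] xp(3)[of n] by metis
  then have "c n * p n (x n (e n)) \<le> q (x n)"
    unfolding q_def using fin[OF xE] c seminorm_on_nonneg[OF p ES[OF xE]]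
    by (intro member_le_sum[where f = "\<lambda>m. c m * p m (x n (e m))"]) auto
  moreover have "c n * p n (x n (e n)) = n" using pos[of n] by (simp add: c_def)
  ultimately show False using M[OF xp(1)[of n]] n by simp
qed

theorem tame_lcs_dsum:
  assumes S: "\<And>i. i \<in> I \<Longrightarrow> lcs (S i) (P i)" and tame: "\<And>i. i \<in> I \<Longrightarrow> tame_lcs (S i) (P i)"
  shows "tame_lcs (dsum_carrier I S) (dsum_seminorms I S P)"
  unfolding tame_lcs_def
proof (intro allI impI)
  let ?E = "dsum_carrier I S" and ?Q = "dsum_seminorms I S P"
  fix B K
  assume B: "lcs_bounded ?E ?Q B" and K: "K \<in> eqc ?E ?Q"
  have lcsE: "lcs ?E ?Q" using S by (rule lcs_dsum)
  have E: "subspace ?E" using lcsE by (rule lcs_subspace)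
  have injE: "dsum_inj i v \<in> ?E" if "i \<in> I" "v \<in> S i" for i v
    using dsum_inj_in_dsum_carrier[of I S, OF _ that] S lcs_subspace by blast
  have xS: "x j \<in> S j" if "x \<in> ?E" "j \<in> I" for x j
    using that unfolding dsum_carrier_def prod_carrier_def by blast
  \<comment> \<open>Seminorms need not separate points: \<open>x\<close> may be nonzero at a
    coordinate outside \<open>J\<close>, but all seminorms of \<open>P i\<close> vanish
    there.\<close>
  define J where "J = {i\<in>I. \<exists>x\<in>B. \<exists>p\<in>P i. p (x i) \<noteq> 0}"
  have J: "finite J" "J \<subseteq> I" using bounded_dsum_finite_support[OF S B] by (auto simp: J_def)
  have inj: "cont_linear (S j) (P j) ?E ?Q (dsum_inj j)" if j: "j \<in> I" for j
    unfolding cont_linear_def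
    using injE[OF j] j by (auto simp: dsum_inj_add dsum_inj_scaleR dsum_seminorms_def)
  show "tame_family K ((\<lambda>b \<phi>. \<phi> b) ` B)"
  proof (rule tame_family_finite_decomposition[OF lcsE K J(1), where S = S and P = P and T = dsum_inj
        and \<pi> = "\<lambda>i x. x i"])
    fix j assume "j \<in> J"
    then have j: "j \<in> I" using J(2) by blast
    show "lcs (S j) (P j)" "tame_lcs (S j) (P j)" using S tame j by blast+
    show "cont_linear (S j) (P j) ?E ?Q (dsum_inj j)" using j by (rule inj)
    show "lcs_bounded (S j) (P j) ((\<lambda>x. x j) ` B)"
      unfolding lcs_bounded_def
    proof
      show "(\<lambda>x. x j) ` B \<subseteq> S j" using B xS j unfolding lcs_bounded_def by blast
      show "\<forall>p\<in>P j. \<exists>M. \<forall>x\<in>(\<lambda>x. x j) ` B. p x \<le> M"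
      proof
        fix p assume "p \<in> P j"
        then have "(\<lambda>x. p (x j)) \<in> ?Q" using seminorm_on_dsum_coordinate[of I S P, OF S j] by blast
        then show "\<exists>M. \<forall>x\<in>(\<lambda>x. x j) ` B. p x \<le> M" using B unfolding lcs_bounded_def by fast
      qed
    qed
  next
    fix \<phi> x assume \<phi>: "\<phi> \<in> K" and xB: "x \<in> B"
    then have x: "x \<in> ?E" using B unfolding lcs_bounded_def by blast
    have lin: "linear_functional_on ?E \<phi>" using eqc_linear[OF K \<phi>] .
    \<comment> \<open>The support of \<open>x\<close> is finite but depends on \<open>x\<close>; its
      part outside \<open>J\<close> is discarded below.\<close>
    define N where "N = J \<union> {i. x i \<noteq> 0}"
    have N: "finite N" "N \<subseteq> I"
      using J x unfolding N_def dsum_carrier_def prod_carrier_def by auto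
    have "x = (\<Sum>j\<in>N. dsum_inj j (x j))"
      unfolding sum_dsum_inj[OF N(1)] by (auto simp: N_def)
    moreover have "dsum_inj j (x j) \<in> ?E" if "j \<in> N" for j using injE xS[OF x] N(2) that by blast
    ultimately have "\<phi> x = (\<Sum>j\<in>N. \<phi> (dsum_inj j (x j)))"
      using linear_functional_on_sum[OF E lin N(1), of "\<lambda>j. dsum_inj j (x j)"] by simp
    also have "\<dots> = (\<Sum>j\<in>J. \<phi> (dsum_inj j (x j)))"
    proof (rule sum.mono_neutral_right[OF N(1)])
      show "J \<subseteq> N" by (simp add: N_def)
      show "\<forall>j\<in>N - J. \<phi> (dsum_inj j (x j)) = 0"
      proof
        fix j assume j: "j \<in> N - J"
        then have jI: "j \<in> I" using N(2) by blast
        \<comment> \<open>The pullback to the \<open>j\<close>-th summand is bounded by seminorms of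
          \<open>P j\<close>, all of which vanish at \<open>x j\<close>.\<close>
        obtain F C where F: "F \<subseteq> P j" "\<And>\<psi> v. \<psi> \<in> pullback (S j) (dsum_inj j) ` K \<Longrightarrow> v \<in> S j
            \<Longrightarrow> \<bar>\<psi> v\<bar> \<le> C * (\<Sum>p\<in>F. p v)"
          using eqcE[OF S[OF jI] eqc_pullback[OF S[OF jI] lcsE inj[OF jI] K]] by metis
        have "p (x j) = 0" if "p \<in> F" for p using that F(1) j jI xB unfolding J_def by blast
        then have "(\<Sum>p\<in>F. p (x j)) = 0" by (intro sum.neutral) blast
        then have "\<bar>pullback (S j) (dsum_inj j) \<phi> (x j)\<bar> \<le> C * 0"
          using F(2)[of "pullback (S j) (dsum_inj j) \<phi>" "x j"] \<phi> xS[OF x jI] by simp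
        then show "\<phi> (dsum_inj j (x j)) = 0" using xS[OF x jI] by (simp add: pullback_def)
      qed
    qed
    finally show "\<phi> x = (\<Sum>j\<in>J. \<phi> (dsum_inj j (x j)))" .
  qed
qed

section \<open>Large dense subspaces and completions\<close>

theorem tame_lcs_large_dense:
  assumes lcs: "lcs S P" and large: "large_dense S P F" and tame: "tame_lcs F P"
  shows "tame_lcs S P"
proof (rule tame_lcsI, rule notI)
  fix B K and b :: "nat \<Rightarrow> 'a"
  assume B: "lcs_bounded S P B" and K: "K \<in> eqc S P" and b: "\<And>n. b n \<in> B"
    and ind: "independent_seq K (\<lambda>n \<phi>. \<phi> (b n))"
  have F: "subspace F" "F \<subseteq> S" using large unfolding large_dense_def by blast+
  have lcsF: "lcs F P" using lcs F by (rule lcs_subset)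
  obtain B' where B': "B' \<subseteq> F" "lcs_bounded S P B'" "B \<subseteq> lcs_closure S P B'"
    using large B unfolding large_dense_def by blast
  then have bdF: "lcs_bounded F P B'" unfolding lcs_bounded_def by blast
  obtain G C where G: "finite G" "G \<subseteq> P" "0 \<le> C" "\<And>\<phi> x. \<phi> \<in> K \<Longrightarrow> x \<in> S \<Longrightarrow> \<bar>\<phi> x\<bar> \<le> C * (\<Sum>p\<in>G. p x)"
    using eqcE[OF lcs K] by metis
  obtain s t where st: "s < t" and i: "\<And>P Q. finite P \<and> finite Q \<and> P \<inter> Q = {} \<Longrightarrow>
      \<exists>\<phi>\<in>K. (\<forall>n\<in>P. \<phi> (b n) < s) \<and> (\<forall>n\<in>Q. t < \<phi> (b n))"
    using independent_seqD[OF ind] by metis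
  \<comment> \<open>Moving every value by at most \<open>d\<close> keeps a gap of
    \<open>2 * d\<close> between the new thresholds.\<close>
  define d where "d = (t - s) / 4"
  have d: "0 < d" using st by (simp add: d_def)
  \<comment> \<open>Only the finitely many seminorms bounding \<open>K\<close> have to be small, so
    the approximation is uniform over \<open>K\<close>. The denominator \<open>C + 1\<close> covers
    the case \<open>C = 0\<close>.\<close>
  have "\<exists>y. y \<in> B' \<and> (\<Sum>p\<in>G. p (b n - y)) < d / (C + 1)" for n
  proof -
    have "b n \<in> lcs_closure S P B'" using b B'(3) by blast
    moreover have "0 < d / (C + 1)" using d G(3) by simp
    ultimately show ?thesis using G(1,2) unfolding lcs_closure_def by blast
  qed
  then obtain y where y: "\<And>n. y n \<in> B'" "\<And>n. (\<Sum>p\<in>G. p (b n - y n)) < d / (C + 1)" by metis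
  have yF: "y n \<in> F" for n using y(1) B'(1) by blast
  have near: "\<bar>\<phi> (b n) - \<phi> (y n)\<bar> \<le> d" if \<phi>: "\<phi> \<in> K" for \<phi> n
  proof -
    have lin: "linear_functional_on S \<phi>" using eqc_linear[OF K \<phi>] .
    have S: "b n \<in> S" "y n \<in> S" "b n - y n \<in> S"
      using b[of n] B yF[of n] F(2) lcs_subspace[OF lcs] unfolding lcs_bounded_def
      by (auto intro: subspace_diff)
    have "\<phi> ((b n - y n) + y n) = \<phi> (b n - y n) + \<phi> (y n)"
      using lin S unfolding linear_functional_on_def by blast
    then have "\<bar>\<phi> (b n) - \<phi> (y n)\<bar> = \<bar>\<phi> (b n - y n)\<bar>" by simp
    also have "\<dots> \<le> C * (\<Sum>p\<in>G. p (b n - y n))" using G(4)[OF \<phi> S(3)] .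
    also have "\<dots> \<le> C * (d / (C + 1))" using y(2)[of n] G(3) by (intro mult_left_mono) auto
    also have "\<dots> \<le> d" using G(3) d by (simp add: field_simps)
    finally show ?thesis .
  qed
  have "independent_seq K (\<lambda>n \<phi>. \<phi> (y n))"
    unfolding independent_seq_def
  proof (rule exI[of _ "s + d"], rule exI[of _ "t - d"], intro conjI allI impI)
    show "s + d < t - d" using st by (simp add: d_def field_simps)
    fix P Q :: "nat set" assume "finite P \<and> finite Q \<and> P \<inter> Q = {}"
    then have "\<exists>\<phi>\<in>K. (\<forall>n\<in>P. \<phi> (b n) < s) \<and> (\<forall>n\<in>Q. t < \<phi> (b n))" by (rule i)
    then obtain \<phi> where \<phi>: "\<phi> \<in> K" "\<forall>n\<in>P. \<phi> (b n) < s" "\<forall>n\<in>Q. t < \<phi> (b n)" by blast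
    show "\<exists>\<phi>\<in>K. (\<forall>n\<in>P. \<phi> (y n) < s + d) \<and> (\<forall>n\<in>Q. t - d < \<phi> (y n))"
    proof (rule bexI[OF _ \<phi>(1)], intro conjI ballI)
      fix n assume "n \<in> P"
      then have "\<phi> (b n) < s" using \<phi>(2) by blast
      then show "\<phi> (y n) < s + d" using near[OF \<phi>(1), of n] by linarith
    next
      fix n assume "n \<in> Q"
      then have "t < \<phi> (b n)" using \<phi>(3) by blast
      then show "t - d < \<phi> (y n)" using near[OF \<phi>(1), of n] by linarith
    qed
  qed
  \<comment> \<open>Pulling back along the inclusion restricts the functionals to \<open>F\<close>,
    where tameness is available.\<close>
  then have "independent_seq (pullback F (\<lambda>x. x) ` K) (\<lambda>n \<phi>. \<phi> (y n))"
    by (rule independent_seq_map[where h = "pullback F (\<lambda>x. x)"]) (use yF in \<open>auto simp: pullback_def\<close>)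
  moreover have "cont_linear F P S P (\<lambda>x. x)"
    unfolding cont_linear_def
  proof (intro conjI ballI)
    fix q assume "q \<in> P"
    then show "dominated F P q" unfolding dominated_def by (intro exI[of _ "{q}"] exI[of _ 1]) simp
  qed (use F in auto)
  ultimately show False using tame_lcsD[where b = y, OF tame bdF eqc_pullback[OF lcsF lcs _ K] y(1)] by blast
qed

lemma lcs_norm: "subspace S \<Longrightarrow> lcs S {norm}"
  unfolding lcs_def seminorm_on_def by (simp add: norm_triangle_ineq)

text \<open>Tameness first reaches the isometric copy \<open>range j\<close>, as a bound covering
  image, and then the whole space, in which this copy is large and dense.\<close>

theorem tame_lcs_completion:
  fixes j :: "'a::real_normed_vector \<Rightarrow> 'b::real_normed_vector"
  assumes j: "linear j" "\<And>x. norm (j x) = norm x" and dense: "closure (range j) = UNIV"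
    and tame: "tame_lcs (UNIV::'a set) {norm}"
  shows "tame_lcs (UNIV::'b set) {norm}"
proof (rule tame_lcs_large_dense)
  have R: "subspace (range j)" using j(1) by (intro linear_subspace_image subspace_UNIV)
  show "lcs (UNIV::'b set) {norm}" by (intro lcs_norm subspace_UNIV)
  show "tame_lcs (range j) {norm}"
  proof (rule tame_lcs_bound_covering[OF lcs_norm[OF subspace_UNIV] lcs_norm[OF R] tame])
    show "bound_covering UNIV {norm} (range j) {norm} j"
      unfolding bound_covering_def cont_linear_def
    proof (intro conjI allI impI ballI)
      fix q assume "q \<in> {norm :: 'b \<Rightarrow> real}"
      then show "dominated UNIV {norm} (\<lambda>x. q (j x))"
        unfolding dominated_def by (intro exI[of _ "{norm}"] exI[of _ 1]) (simp add: j(2))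
    next
      fix B assume B: "lcs_bounded (range j) {norm} B"
      then have "lcs_bounded UNIV {norm} (j -` B)" unfolding lcs_bounded_def by (auto simp flip: j(2))
      moreover have "j ` (j -` B) = B" using B unfolding lcs_bounded_def by auto
      ultimately show "\<exists>B1. lcs_bounded UNIV {norm} B1 \<and> j ` B1 = B" by blast
    qed (use j(1) in \<open>auto simp: linear_add linear_scale\<close>)
  qed
  have approx: "\<exists>y\<in>range j. norm (x - y) < e" if "0 < e" for x e
    using dense that closure_approachable[of x "range j"] by (auto simp: dist_norm norm_minus_commute)
  have closureI: "x \<in> lcs_closure UNIV {norm} A" if near: "\<And>e. 0 < e \<Longrightarrow> \<exists>y\<in>A. norm (x - y) < e" for x :: 'b and A
    unfolding lcs_closure_def
  proof (intro CollectI conjI allI impI; (elim conjE)?)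
    fix G :: "('b \<Rightarrow> real) set" and e :: real assume "G \<subseteq> {norm}" and e: "0 < e"
    \<comment> \<open>The closure also tests the empty family: its sum is 0, but a point of
      \<open>A\<close> is still required.\<close>
    then have "G = {} \<or> G = {norm}" by blast
    moreover obtain y where "y \<in> A" "norm (x - y) < e" using near[OF e] by blast
    ultimately show "\<exists>y\<in>A. (\<Sum>p\<in>G. p (x - y)) < e" using e by auto
  qed simp
  show "large_dense UNIV {norm} (range j)"
    unfolding large_dense_def
  proof (intro conjI allI impI)
    show "UNIV \<subseteq> lcs_closure UNIV {norm} (range j)" using closureI approx by blast
    fix B :: "'b set" assume "lcs_bounded UNIV {norm} B"
    then obtain M where M: "\<And>x. x \<in> B \<Longrightarrow> norm x \<le> M" unfolding lcs_bounded_def by auto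
    \<comment> \<open>The radius grows by 1 because approximants are chosen within distance
      \<open>min e 1\<close>.\<close>
    define B' where "B' = {y \<in> range j. norm y \<le> M + 1}"
    have "x \<in> lcs_closure UNIV {norm} B'" if x: "x \<in> B" for x
    proof (rule closureI)
      fix e :: real assume "0 < e"
      then obtain y where y: "y \<in> range j" "norm (x - y) < min e 1" using approx[of "min e 1" x] by auto
      have "norm y \<le> norm x + norm (x - y)" using norm_triangle_ineq4[of x "x - y"] by simp
      then have "y \<in> B'" using y M[OF x] by (simp add: B'_def)
      then show "\<exists>y\<in>B'. norm (x - y) < e" using y(2) by auto
    qed
    then show "\<exists>B'\<subseteq>range j. lcs_bounded UNIV {norm} B' \<and> B \<subseteq> lcs_closure UNIV {norm} B'"
      by (intro exI[of _ B']) (auto simp: B'_def lcs_bounded_def)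
  qed (use R in auto)
qed

text \<open>The completion is represented by a Banach space with a norm-preserving linear map of
  dense range into it, which determines it up to isometry. Each clause has its own type variables,
  so the clauses can be instantiated independently.\<close>

theorem theorem5p6:
  shows
  "(\<forall>(S::'a::real_vector set) P L. lcs S P \<and> tame_lcs S P \<and> subspace L \<and> L \<subseteq> S \<longrightarrow> tame_lcs L P)
 \<and> (\<forall>(S1::'b::real_vector set) P1 (S2::'c::real_vector set) P2 f.
      lcs S1 P1 \<and> lcs S2 P2 \<and> tame_lcs S1 P1 \<and> bound_covering S1 P1 S2 P2 f \<longrightarrow> tame_lcs S2 P2)
 \<and> (\<forall>(I::'i set) (S::'i \<Rightarrow> 'd::real_vector set) P.
      (\<forall>i\<in>I. lcs (S i) (P i) \<and> tame_lcs (S i) (P i)) \<longrightarrow>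
      tame_lcs (prod_carrier I S) (prod_seminorms I P))
 \<and> (\<forall>(I::'j set) (S::'j \<Rightarrow> 'e::real_vector set) P.
      (\<forall>i\<in>I. lcs (S i) (P i) \<and> tame_lcs (S i) (P i)) \<longrightarrow>
      tame_lcs (dsum_carrier I S) (dsum_seminorms I S P))
 \<and> (\<forall>(I::'k set) le (S::'k \<Rightarrow> 'f::real_vector set) P f.
      inverse_system I le S P f \<and> (\<forall>i\<in>I. tame_lcs (S i) (P i)) \<longrightarrow>
      tame_lcs (invlim_carrier I le S f) (prod_seminorms I P))
 \<and> (\<forall>(S::'g::real_vector set) P F.
      lcs S P \<and> large_dense S P F \<and> tame_lcs F P \<longrightarrow> tame_lcs S P)
 \<and> (\<forall>j::'h::real_normed_vector \<Rightarrow> 'l::banach.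
      linear j \<and> (\<forall>x. norm (j x) = norm x) \<and> closure (range j) = UNIV \<and>
      tame_lcs (UNIV::'h set) {norm} \<longrightarrow> tame_lcs (UNIV::'l set) {norm})"
proof (intro conjI allI impI; (elim conjE)?)
  fix S :: "'a set" and P L
  assume "lcs S P" "tame_lcs S P" "subspace L" "L \<subseteq> S"
  then show "tame_lcs L P" by (rule tame_lcs_subspace)
next
  fix S1 :: "'b set" and P1 and S2 :: "'c set" and P2 f
  assume "lcs S1 P1" "lcs S2 P2" "tame_lcs S1 P1" "bound_covering S1 P1 S2 P2 f"
  then show "tame_lcs S2 P2" by (rule tame_lcs_bound_covering)
next
  fix I :: "'i set" and S :: "'i \<Rightarrow> 'd set" and P
  assume "\<forall>i\<in>I. lcs (S i) (P i) \<and> tame_lcs (S i) (P i)"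
  then show "tame_lcs (prod_carrier I S) (prod_seminorms I P)" by (intro tame_lcs_prod) auto
next
  fix I :: "'j set" and S :: "'j \<Rightarrow> 'e set" and P
  assume "\<forall>i\<in>I. lcs (S i) (P i) \<and> tame_lcs (S i) (P i)"
  then show "tame_lcs (dsum_carrier I S) (dsum_seminorms I S P)" by (intro tame_lcs_dsum) auto
next
  fix I :: "'k set" and le and S :: "'k \<Rightarrow> 'f set" and P f
  assume "inverse_system I le S P f" "\<forall>i\<in>I. tame_lcs (S i) (P i)"
  then show "tame_lcs (invlim_carrier I le S f) (prod_seminorms I P)" by (blast intro: tame_lcs_invlim)
next
  fix S :: "'g set" and P F
  assume "lcs S P" "large_dense S P F" "tame_lcs F P"
  then show "tame_lcs S P" by (rule tame_lcs_large_dense)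
next
  fix j :: "'h \<Rightarrow> 'l"
  assume "linear j" "\<forall>x. norm (j x) = norm x" "closure (range j) = UNIV" "tame_lcs (UNIV::'h set) {norm}"
  then show "tame_lcs (UNIV::'l set) {norm}" by (blast intro: tame_lcs_completion)
qed

end
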